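(* Let $A,B$ be two elements of a unital JB-algebra $\mathfrak A$ and let $\lambda\in(0,1)$. Then \begin{align*} \exp[(1-\lambda)A+\lambda B]&=\lim_{t\to0}\left[(1-\lambda)e^{tA}+\lambda e^{tB}\right]^{1/t}=\lim_{n\to\infty}\left[(1-\lambda)e^{A/n}+\lambda e^{B/n}\right]^{n}\\ &=\lim_{t\to0}\left[(1-\lambda)e^{-tA}+\lambda e^{-tB}\right]^{-1/t}=\lim_{n\to\infty}\left[(1-\lambda)e^{-A/n}+\lambda e^{-B/n}\right]^{-n}\\ &=\lim_{t\to0}\left(e^{tA}\#_\lambda e^{tB}\right)^{1/t}=\lim_{n\to\infty}\left(e^{A/n}\#_\lambda e^{B/n}\right)^{n}\\ &=\lim_{t\to0}\left(e^{tA}\natural_\lambda e^{tB}\right)^{1/t}=\lim_{n\to\infty}\left(e^{A/n}\natural_\lambda e^{B/n}\right)^{n}. \end{align*}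
   Context: A (real) Jordan algebra is a real vector space $\mathfrak A$ with a bilinear product $\circ$ satisfying $A\circ B=B\circ A$ and $(A^2\circ B)\circ A=A^2\circ(B\circ A)$, where $A^2=A\circ A$. A JB-algebra is a Jordan algebra over $\mathbb R$ with a complete norm such that $\|A\circ B\|\le\|A\|\|B\|$, $\|A^2\|=\|A\|^2$ and $\|A^2\|\le\|A^2+B^2\|$. In a unital JB-algebra with unit $I$, $A$ is invertible with (Jordan) inverse $B=A^{-1}$ if $A\circ B=I$ and $A^2\circ B=A$; the spectrum of $A$ is $\{\lambda\in\mathbb R: A-\lambda I \text{ is not invertible}\}$; $A$ is positive ($A\ge0$) if its spectrum lies in $[0,\infty)$. $\mathfrak A_{++}$ is the open convex cone of positive invertible elements. Real powers, $\exp$ and $\log$ are given by functional calculus in $\mathfrak A$. The triple product is $\{ABA\}:=2(A\circ B)\circ A-A^2\circ B$. For $A,B\in\mathfrak A_{++}$ the weighted geometric mean is $A\#_\lambda B=\{A^{1/2}\{A^{-1/2}BA^{-1/2}\}^{\lambda}A^{1/2}\}$, with $A\#B:=A\#_{1/2}B$, and the weighted spectral geometric mean is $A\natural_\lambda B=\{(A^{-1}\#B)^\lambda A(A^{-1}\#B)^\lambda\}$. *)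

theory Defs
  imports "HOL-Analysis.Analysis"
begin

class jordan_algebra = real_vector + times +
  assumes jordan_add_left: "(a + b) * c = a * c + b * c"
    and jordan_scaleR_left: "(r *\<^sub>R a) * b = r *\<^sub>R (a * b)"
    and jordan_commute: "a * b = b * a"
    and jordan_identity: "((a * a) * b) * a = (a * a) * (b * a)"

class jb_algebra = jordan_algebra + banach +
  assumes jb_norm_mult: "norm (a * b) \<le> norm a * norm b"
    and jb_norm_square: "norm (a * a) = (norm a)\<^sup>2"
    and jb_norm_square_add: "norm (a * a) \<le> norm (a * a + b * b)"

text \<open>
  The unit is not required to differ from 0, so the zero algebra is included.
\<close>
class unital_jb_algebra = jb_algebra + one +
  assumes jb_one_left: "1 * a = a"

definition jb_is_inverse :: "'a::unital_jb_algebra \<Rightarrow> 'a \<Rightarrow> bool" where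
  "jb_is_inverse A B \<longleftrightarrow> A * B = 1 \<and> (A * A) * B = A"

definition jb_invertible :: "'a::unital_jb_algebra \<Rightarrow> bool" where
  "jb_invertible A \<longleftrightarrow> (\<exists>B. jb_is_inverse A B)"

definition jb_inverse :: "'a::unital_jb_algebra \<Rightarrow> 'a" where
  "jb_inverse A = (THE B. jb_is_inverse A B)"

definition jb_spectrum :: "'a::unital_jb_algebra \<Rightarrow> real set" where
  "jb_spectrum A = {r. \<not> jb_invertible (A - r *\<^sub>R 1)}"

text \<open>
  The continuous functional calculus of \<open>A\<close> is the isometric unital homomorphism
  \<open>\<Phi>\<close> from the continuous real functions on the spectrum of \<open>A\<close> (with the supremum norm)
  into the algebra that sends the identity function to \<open>A\<close>. An element of this
  function space is represented by any \<open>f :: real \<Rightarrow> real\<close> continuous on the spectrum;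
  the isometry condition forces \<open>\<Phi> f\<close> to depend only on \<open>f\<close> restricted to the spectrum.
  That condition is phrased through upper bounds rather than \<open>Sup\<close> because the
  spectrum is empty in the zero algebra.
\<close>
definition jb_functional_calculus ::
    "'a::unital_jb_algebra \<Rightarrow> ((real \<Rightarrow> real) \<Rightarrow> 'a) \<Rightarrow> bool" where
  "jb_functional_calculus A \<Phi> \<longleftrightarrow>
     (\<forall>f g. continuous_on (jb_spectrum A) f \<longrightarrow> continuous_on (jb_spectrum A) g \<longrightarrow>
        \<Phi> (\<lambda>x. f x + g x) = \<Phi> f + \<Phi> g \<and>
        \<Phi> (\<lambda>x. f x * g x) = \<Phi> f * \<Phi> g) \<and>
     (\<forall>f c. continuous_on (jb_spectrum A) f \<longrightarrow> \<Phi> (\<lambda>x. c * f x) = c *\<^sub>R \<Phi> f) \<and>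
     \<Phi> (\<lambda>x. 1) = 1 \<and>
     \<Phi> (\<lambda>x. x) = A \<and>
     (\<forall>f c. continuous_on (jb_spectrum A) f \<longrightarrow> 0 \<le> c \<longrightarrow>
        (norm (\<Phi> f) \<le> c \<longleftrightarrow> (\<forall>x\<in>jb_spectrum A. \<bar>f x\<bar> \<le> c)))"

text \<open>
  By Stone--Weierstrass, all maps satisfying \<open>jb_functional_calculus A\<close> agree on functions
  that are continuous on the spectrum, so for such functions the choice is immaterial.
\<close>
definition jb_apply :: "(real \<Rightarrow> real) \<Rightarrow> 'a::unital_jb_algebra \<Rightarrow> 'a" where
  "jb_apply f A = (SOME \<Phi>. jb_functional_calculus A \<Phi>) f"

definition jb_exp :: "'a::unital_jb_algebra \<Rightarrow> 'a" where
  "jb_exp A = jb_apply exp A"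

text \<open>
  Meaningful for positive invertible \<open>A\<close>, whose spectrum lies in \<open>{0<..}\<close>,
  where \<open>\<lambda>x. x powr r\<close> is continuous.
\<close>
definition jb_powr :: "'a::unital_jb_algebra \<Rightarrow> real \<Rightarrow> 'a" (infixr \<open>jpowr\<close> 80) where
  "A jpowr r = jb_apply (\<lambda>x. x powr r) A"

text \<open>\<open>jb_triple A B\<close> is \<open>{A B A}\<close>.\<close>
definition jb_triple :: "'a::unital_jb_algebra \<Rightarrow> 'a \<Rightarrow> 'a" where
  "jb_triple A B = 2 *\<^sub>R ((A * B) * A) - (A * A) * B"

definition jb_gmean :: "real \<Rightarrow> 'a::unital_jb_algebra \<Rightarrow> 'a \<Rightarrow> 'a" where
  "jb_gmean l A B =
     jb_triple (A jpowr (1/2)) ((jb_triple (A jpowr (-1/2)) B) jpowr l)"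

definition jb_spectral_gmean :: "real \<Rightarrow> 'a::unital_jb_algebra \<Rightarrow> 'a \<Rightarrow> 'a" where
  "jb_spectral_gmean l A B = jb_triple ((jb_gmean (1/2) (jb_inverse A) B) jpowr l) A"

end

theory Submission
  imports Defs "HOL-Computational_Algebra.Fundamental_Theorem_Algebra"
begin

text \<open>
  All eight limits are instances of one fact. If \<open>F\<close> is a curve with \<open>F 0 = 1\<close> that is
  differentiable at \<open>0\<close>, then \<open>F t jpowr (1/t) = exp ((1/t) log (F t))\<close> for small \<open>t \<noteq> 0\<close>. The
  derivative of \<open>log\<close> at the unit is the identity, so \<open>(1/t) log (F t)\<close> tends to the derivative of
  \<open>F\<close> at \<open>0\<close>, and \<open>exp\<close> is continuous (\<open>unit_tangent_powr_limit\<close>). The weighted arithmetic,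
  geometric and spectral geometric means of \<open>exp (t A)\<close> and \<open>exp (t B)\<close> are all such curves. The
  product rule and the chain rule show that each has the same derivative \<open>(1 - l) A + l B\<close>. Replacing
  \<open>t\<close> by \<open>- t\<close>, \<open>1/n\<close> and \<open>- (1/n)\<close> gives the other forms.

  The chain rule rests on one estimate. The calculus is isometric and every spectral value \<open>x\<close> of
  \<open>a\<close> satisfies \<open>\<bar>x - r\<bar> \<le> norm (a - r 1)\<close>. A first-order expansion of a real function \<open>f\<close> at \<open>r\<close>
  therefore holds for \<open>jb_apply f\<close> at \<open>r 1\<close> with the same error constant
  (\<open>jb_apply_has_derivative\<close>).

  Since \<open>jb_apply\<close> chooses a functional calculus, everything depends on the existence of one
  (\<open>ex_functional_calculus\<close>), and most of the development is devoted to it. It avoids characters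
  and Gelfand theory and works in the closure of the polynomials in \<open>a\<close>:

  \<^item> Powers of one element multiply as they should (\<open>jb_power_mult\<close>), so polynomials can be evaluated
    at \<open>a\<close> multiplicatively, and the closure of their values is an associative algebra.

  \<^item> In this algebra an element close to a positive multiple of the unit is a square. A real
    polynomial that is positive on \<open>[-R, R]\<close>, where \<open>R > norm a\<close>, factors into linear and quadratic
    polynomials whose values at \<open>a\<close> are of this kind, hence is a square at \<open>a\<close>
    (\<open>positive_poly_strictly_positive\<close>). Applied to \<open>c\<^sup>2 + e - q\<^sup>2\<close>, together with
    \<open>norm (x x) \<le> norm (x x + y y)\<close>, this bounds \<open>norm (q(a))\<close> by the supremum of \<open>\<bar>q\<bar>\<close> on \<open>[-R, R]\<close>
    (\<open>norm_jb_poly_le\<close>). The Weierstrass approximation theorem then extends the evaluation to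
    continuous functions on that interval.

  \<^item> The spectrum, although defined by Jordan inverses in the whole algebra, is the support of this
    extended calculus: \<open>r\<close> is not a spectral value iff all functions supported in some neighbourhood
    of \<open>r\<close> are sent to \<open>0\<close> (\<open>locally_null_off_spectrum\<close>, \<open>locally_null_imp_off_spectrum\<close>). Hence the
    calculus factors isometrically through the continuous functions on the spectrum.
\<close>

section \<open>Power associativity and Jordan inverses\<close>

lemma jordan_add_right: "(c::'a::jordan_algebra) * (a + b) = c * a + c * b"
  by (metis jordan_add_left jordan_commute)

lemma jordan_scaleR_right: "(a::'a::jordan_algebra) * (r *\<^sub>R b) = r *\<^sub>R (a * b)"
  by (metis jordan_scaleR_left jordan_commute)

lemma jordan_zero_left [simp]: "0 * (a::'a::jordan_algebra) = 0"
  using jordan_scaleR_left[of 0 0 a] by simp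

lemma jordan_zero_right [simp]: "(a::'a::jordan_algebra) * 0 = 0"
  using jordan_scaleR_right[of a 0 0] by simp

lemma jordan_minus_left: "- a * (b::'a::jordan_algebra) = - (a * b)"
  using jordan_scaleR_left[of "-1" a b] by simp

lemma jordan_minus_right: "(a::'a::jordan_algebra) * (- b) = - (a * b)"
  using jordan_scaleR_right[of a "-1" b] by simp

lemma jordan_diff_left: "(a - b) * (c::'a::jordan_algebra) = a * c - b * c"
  using jordan_add_left[of a "-b" c] by (simp add: jordan_minus_left)

lemma jordan_diff_right: "(c::'a::jordan_algebra) * (a - b) = c * a - c * b"
  using jordan_add_right[of c a "-b"] by (simp add: jordan_minus_right)

lemmas jordan_distribs = jordan_add_left jordan_add_right jordan_diff_left jordan_diff_right
  jordan_minus_left jordan_minus_right jordan_scaleR_left jordan_scaleR_right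

definition mult_commutator :: "'a::jordan_algebra \<Rightarrow> 'a \<Rightarrow> 'a \<Rightarrow> 'a" where
  "mult_commutator u v x = u * (v * x) - v * (u * x)"

lemma mult_commutator_add_left:
    "mult_commutator (u + u') v x = mult_commutator u v x + mult_commutator u' v x"
  and mult_commutator_add_right:
    "mult_commutator u (v + v') x = mult_commutator u v x + mult_commutator u v' x"
  and mult_commutator_minus_left: "mult_commutator (- u) v x = - mult_commutator u v x"
  and mult_commutator_minus_right: "mult_commutator u (- v) x = - mult_commutator u v x"
  by (simp_all add: mult_commutator_def jordan_distribs algebra_simps)

lemma mult_commutator_square: "mult_commutator (a * a) a x = 0"
  using jordan_identity[of a x]
  by (simp add: mult_commutator_def jordan_commute)

lemma double_eq_zero: "(z::'a::real_vector) + z = 0 \<Longrightarrow> z = 0"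
  by (metis scaleR_2 scaleR_eq_0_iff zero_neq_numeral)

text \<open>
  The cubic identity \<open>mult_commutator_square\<close> at \<open>a + b\<close> and at \<open>a - b\<close>: the difference of the two
  expansions isolates the part that is linear in \<open>b\<close>, here with a factor two.
\<close>

lemma mult_commutator_polarized_once:
  "mult_commutator (a * a) b x + (mult_commutator (a * b) a x + mult_commutator (a * b) a x) = 0"
proof -
  let ?D = "\<lambda>u v. mult_commutator u v x"
  have 1: "?D (a * a) b + (?D (a * b) a + ?D (a * b) a) + (?D (a * b) b + ?D (a * b) b) + ?D (b * b) a = 0"
    using mult_commutator_square[of "a + b" x] mult_commutator_square[of a x] mult_commutator_square[of b x]
    by (simp add: jordan_distribs mult_commutator_add_left mult_commutator_add_right
        jordan_commute[of b a] algebra_simps)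
  have 2: "- ?D (a * a) b - (?D (a * b) a + ?D (a * b) a) + (?D (a * b) b + ?D (a * b) b) + ?D (b * b) a = 0"
    using mult_commutator_square[of "a + (- b)" x] mult_commutator_square[of a x] mult_commutator_square[of b x]
    by (simp only: jordan_distribs mult_commutator_add_left mult_commutator_add_right
        mult_commutator_minus_left mult_commutator_minus_right minus_minus
        jordan_commute[of b a]) (simp add: algebra_simps)
  have "?D (a * a) b + (?D (a * b) a + ?D (a * b) a) + (?D (a * a) b + (?D (a * b) a + ?D (a * b) a)) = 0"
    using 1 2 by (simp add: algebra_simps)
  then show ?thesis by (rule double_eq_zero)
qed

text \<open>
  The remaining square is polarized in the same way. In terms of the multiplication operators
  \<open>L u = (\<lambda>x. u * x)\<close> the result is the linearized Jordan identity
  \<open>[L (a b), L c] + [L (b c), L a] + [L (c a), L b] = 0\<close>.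
\<close>

lemma mult_commutator_polarized:
  "mult_commutator (a * b) c x + mult_commutator (b * c) a x + mult_commutator (c * a) b x = 0"
proof -
  let ?D = "\<lambda>u v. mult_commutator u v x"
  define E where "E u = ?D (u * u) b + (?D (u * b) u + ?D (u * b) u)" for u
  have expand: "E (a + c) = E a + E c
      + ((?D (a * b) c + ?D (b * c) a + ?D (c * a) b) + (?D (a * b) c + ?D (b * c) a + ?D (c * a) b))"
    by (simp add: E_def jordan_distribs mult_commutator_add_left mult_commutator_add_right
        jordan_commute[of a c] jordan_commute[of c b] algebra_simps)
  have "(?D (a * b) c + ?D (b * c) a + ?D (c * a) b) + (?D (a * b) c + ?D (b * c) a + ?D (c * a) b) = 0"
  proof -
    have "E u = 0" for u unfolding E_def by (rule mult_commutator_polarized_once)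
    then show ?thesis using expand by simp
  qed
  then show ?thesis by (rule double_eq_zero)
qed

lemma jordan_four_element_identity:
  "(a * b) * (c * x) + (b * c) * (a * x) + (c * a) * (b * x)
     = c * ((a * b) * x) + a * ((b * c) * x) + b * ((c * a) * (x::'a::jordan_algebra))"
  using mult_commutator_polarized[of a b c x] by (simp add: mult_commutator_def algebra_simps)

primrec jb_power :: "'a::unital_jb_algebra \<Rightarrow> nat \<Rightarrow> 'a" where
  "jb_power a 0 = 1"
| "jb_power a (Suc n) = a * jb_power a n"

declare jb_one_left [simp]

lemma jb_one_right [simp]: "(a::'a::unital_jb_algebra) * 1 = a"
  by (metis jb_one_left jordan_commute)

text \<open>
  Induction on the total degree \<open>N\<close>. Put \<open>c i = a\<^sup>i a\<^bsup>N-i\<^esup>\<close>. On powers of \<open>a\<close> of total degree \<open>N\<close>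
  all inner products in \<open>jordan_four_element_identity\<close> are known by induction, and the identity
  becomes \<open>c (p+q) + c (q+r) + c (r+p) = c p + c q + c r\<close>. With \<open>p = q = 1\<close> this is the recurrence
  \<open>c 2 + 2 c (r+1) = c r + 2 c 1\<close>, which forces all \<open>c r\<close> to agree with \<open>c 1 = a\<^sup>N\<close>.
\<close>

lemma jb_power_mult: "jb_power a m * jb_power a n = jb_power a (m + n)"
proof -
  have "\<forall>i\<le>N. jb_power a i * jb_power a (N - i) = jb_power a N" for N
  proof (induction N rule: less_induct)
    case (less N)
    define c where "c i = jb_power a i * jb_power a (N - i)" for i
    have IH: "jb_power a i * jb_power a j = jb_power a (i + j)" if "i + j < N" for i j
      using less.IH[OF that] by (metis add_diff_cancel_left' le_add1)
    have c_sym: "c (N - i) = c i" if "i \<le> N" for i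
      using that by (simp add: c_def jordan_commute)
    have c0: "c 0 = jb_power a N" by (simp add: c_def)
    have c1: "c 1 = jb_power a N" if "1 \<le> N"
      using that by (cases N) (auto simp: c_def)
    have quad: "c (p + q) + c (q + r) + c (r + p) = c r + c p + c q"
      if "1 \<le> p" "1 \<le> q" "1 \<le> r" "1 \<le> s" "p + q + r + s = N" for p q r s
    proof -
      let ?P = "jb_power a"
      have e: "N - (p + q) = r + s" "N - (q + r) = p + s" "N - (r + p) = q + s"
        "N - r = p + q + s" "N - p = q + r + s" "N - q = r + p + s"
        using that by auto
      have l: "p + q < N" "q + r < N" "r + p < N" "r + s < N" "p + s < N" "q + s < N"
         "p + q + s < N" "q + r + s < N" "r + p + s < N"
        using that by auto
      have "(?P p * ?P q) * (?P r * ?P s) + (?P q * ?P r) * (?P p * ?P s) + (?P r * ?P p) * (?P q * ?P s)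
        = ?P r * ((?P p * ?P q) * ?P s) + ?P p * ((?P q * ?P r) * ?P s) + ?P q * ((?P r * ?P p) * ?P s)"
        by (rule jordan_four_element_identity)
      then show ?thesis unfolding c_def e using l by (simp add: IH)
    qed
    have step: "c 2 + (c (r + 1) + c (r + 1)) = c r + (c 1 + c 1)" if "1 \<le> r" "r + 3 \<le> N" for r
      using quad[of 1 1 r "N - 2 - r"] that by (simp add: add.commute add.left_commute numeral_2_eq_2)
    have c2: "c 2 = c 1" if "4 \<le> N"
    proof -
      have "c 2 - c 1 + (c 2 - c 1) + (c 2 - c 1) = 0"
        using step[of 1] that by (simp add: algebra_simps numeral_2_eq_2)
      then have "3 *\<^sub>R (c 2 - c 1) = 0"
        using scaleR_add_left[of 2 1 "c 2 - c 1"] by (simp add: scaleR_2)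
      then show ?thesis by simp
    qed
    have mid: "1 \<le> r \<Longrightarrow> r + 2 \<le> N \<Longrightarrow> c r = c 1" for r
    proof (induction r)
      case 0
      then show ?case by simp
    next
      case (Suc r)
      show ?case
      proof (cases "r = 0")
        case False
        then have r: "1 \<le> r" "r + 3 \<le> N" using Suc.prems by auto
        then have "4 \<le> N" by linarith
        have "c (r + 1) - c 1 + (c (r + 1) - c 1) = 0"
          using step[OF r] Suc.IH r c2[OF \<open>4 \<le> N\<close>] by (simp add: algebra_simps)
        from double_eq_zero[OF this] show ?thesis by simp
      qed simp
    qed
    show ?case
    proof (intro allI impI)
      fix i assume "i \<le> N"
      then consider "i = 0" | "i = N" | "i = N - 1" "1 \<le> N" | "1 \<le> i" "i + 2 \<le> N" by linarith
      then have "c i = jb_power a N"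
      proof cases
        case 1
        then show ?thesis using c0 by metis
      next
        case 2
        then show ?thesis using c0 c_sym[of 0] by (metis diff_zero le0)
      next
        case 3
        then show ?thesis using c1 c_sym[of 1] by metis
      next
        case 4
        then have "1 \<le> N" by linarith
        then show ?thesis using mid[OF 4] c1 by metis
      qed
      then show "jb_power a i * jb_power a (N - i) = jb_power a N"
        by (simp add: c_def)
    qed
  qed
  from this[of "m + n"] show ?thesis
    by (metis add_diff_cancel_left' le_add1)
qed

text \<open>
  Strong induction. The linearized identity for \<open>A\<close>, \<open>A\<^bsup>m+1\<^esup>\<close>, \<open>B\<close> is evaluated at \<open>x = A\<close>. Two of its
  terms vanish there: one because \<open>B * A = 1\<close>, the other because \<open>B * A\<^bsup>m+1\<^esup> = A\<^sup>m\<close> by induction and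
  powers of \<open>A\<close> multiply associatively. The third says that \<open>B\<close> and \<open>A\<^bsup>m+2\<^esup>\<close> commute as multiplication
  operators at \<open>A\<close>, which is the claim for the next exponent.
\<close>

lemma jb_inverse_lowers_power:
  assumes "jb_is_inverse A B"
  shows "B * jb_power A (Suc n) = jb_power A n"
proof (induction n rule: less_induct)
  case (less n)
  have AB: "A * B = 1" "(A * A) * B = A"
    using assms by (auto simp: jb_is_inverse_def)
  consider "n = 0" | "n = 1" | m where "n = Suc (Suc m)"
    by (metis One_nat_def nat.exhaust)
  then show ?case
  proof cases
    case (3 m)
    let ?P = "jb_power A"
    have IH: "B * ?P (Suc m) = ?P m" using less.IH[of m] 3 by simp
    have "mult_commutator (A * ?P (Suc m)) B A + mult_commutator (?P (Suc m) * B) A A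
        + mult_commutator (B * A) (?P (Suc m)) A = 0"
      by (rule mult_commutator_polarized)
    moreover have "mult_commutator (?P (Suc m) * B) A A = 0"
      using IH jb_power_mult[of A m 2] jb_power_mult[of A m 1]
      by (simp add: mult_commutator_def jordan_commute[of _ B] numeral_2_eq_2)
    moreover have "mult_commutator (B * A) (?P (Suc m)) A = 0"
      using AB by (simp add: mult_commutator_def jordan_commute[of B A])
    ultimately have "mult_commutator (?P (Suc (Suc m))) B A = 0" by simp
    then show ?thesis
      using AB 3 by (simp add: mult_commutator_def jordan_commute[of B A])
        (metis jordan_commute)
  qed (use AB in \<open>simp_all add: jordan_commute\<close>)
qed

section \<open>Polynomials in one element\<close>

lemma norm_jb_one_le: "norm (1::'a::unital_jb_algebra) \<le> 1"
proof -
  have "norm (1::'a) * norm (1::'a) = norm (1::'a)"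
    using jb_norm_square[of "1::'a"] by (simp add: power2_eq_square)
  then show ?thesis by auto
qed

lemma bounded_bilinear_jb_mult: "bounded_bilinear ((*) :: 'a::jb_algebra \<Rightarrow> 'a \<Rightarrow> 'a)"
  by unfold_locales (auto simp: jordan_distribs intro!: exI[of _ 1] jb_norm_mult)

interpretation jb_mult: bounded_bilinear "(*) :: 'a::jb_algebra \<Rightarrow> 'a \<Rightarrow> 'a"
  by (rule bounded_bilinear_jb_mult)

definition jb_poly :: "real poly \<Rightarrow> 'a::unital_jb_algebra \<Rightarrow> 'a" where
  "jb_poly p a = (\<Sum>i\<le>degree p. coeff p i *\<^sub>R jb_power a i)"

lemma jb_poly_altdef:
  assumes "degree p \<le> n"
  shows "jb_poly p a = (\<Sum>i\<le>n. coeff p i *\<^sub>R jb_power a i)"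
  unfolding jb_poly_def
  using assms by (intro sum.mono_neutral_left) (auto simp: coeff_eq_0)

lemma jb_poly_add: "jb_poly (p + q) a = jb_poly p a + jb_poly q a"
  using jb_poly_altdef[of p "max (degree p) (degree q)" a]
    jb_poly_altdef[of q "max (degree p) (degree q)" a]
    jb_poly_altdef[of "p + q" "max (degree p) (degree q)" a]
  by (simp add: degree_add_le_max scaleR_add_left sum.distrib)

lemma jb_poly_0 [simp]: "jb_poly 0 a = 0"
  by (simp add: jb_poly_def)

lemma jb_poly_smult: "jb_poly (smult c p) a = c *\<^sub>R jb_poly p a"
  using jb_poly_altdef[of "smult c p" "degree p" a]
  by (simp add: jb_poly_def scaleR_sum_right)

lemma jb_poly_diff: "jb_poly (p - q) a = jb_poly p a - jb_poly q a"
  using jb_poly_add[of p "smult (-1) q" a] jb_poly_smult[of "-1" q a] by simp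

lemma jb_poly_sum: "jb_poly (\<Sum>i\<in>S. p i) a = (\<Sum>i\<in>S. jb_poly (p i) a)"
  by (induction S rule: infinite_finite_induct) (auto simp: jb_poly_add)

lemma jb_poly_monom: "jb_poly (monom c n) a = c *\<^sub>R jb_power a n"
proof -
  have "jb_poly (monom c n) a = (\<Sum>i\<le>n. coeff (monom c n) i *\<^sub>R jb_power a i)"
    by (rule jb_poly_altdef) (simp add: degree_monom_le)
  also have "\<dots> = (\<Sum>i\<in>{n}. coeff (monom c n) i *\<^sub>R jb_power a i)"
    by (intro sum.mono_neutral_right) auto
  finally show ?thesis by simp
qed

lemma jb_poly_const [simp]: "jb_poly [:c:] a = c *\<^sub>R 1"
  by (simp add: jb_poly_def)

lemma jb_poly_1 [simp]: "jb_poly 1 a = 1"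
  using jb_poly_const[of 1 a] by (simp add: one_pCons)

lemma jb_poly_linear [simp]: "jb_poly [:c, d:] a = c *\<^sub>R 1 + d *\<^sub>R a"
  by (simp add: jb_poly_def)

lemma jb_poly_mult: "jb_poly (p * q) a = jb_poly p a * jb_poly q a"
proof -
  have pq: "p * q = (\<Sum>i\<le>degree p. \<Sum>j\<le>degree q. monom (coeff p i * coeff q j) (i + j))"
    by (subst (1 2) poly_as_sum_of_monoms[symmetric])
      (simp add: sum_product mult_monom)
  show ?thesis
    unfolding pq jb_poly_sum jb_poly_monom
    unfolding jb_poly_def jb_mult.sum_left jb_mult.sum_right
    by (subst sum.swap) (simp add: jordan_distribs jb_power_mult mult.commute)
qed

definition generated_subalgebra :: "'a::unital_jb_algebra \<Rightarrow> 'a set" where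
  "generated_subalgebra a = closure (range (\<lambda>p. jb_poly p a))"

lemma generated_subalgebra_iff:
  "x \<in> generated_subalgebra a \<longleftrightarrow> (\<exists>p. (\<lambda>n. jb_poly (p n) a) \<longlonglongrightarrow> x)"
proof
  assume "x \<in> generated_subalgebra a"
  then obtain f where f: "\<forall>n. f n \<in> range (\<lambda>p. jb_poly p a)" "f \<longlonglongrightarrow> x"
    unfolding generated_subalgebra_def closure_sequential by auto
  then have "\<forall>n. \<exists>q. f n = jb_poly q a" by (simp add: image_iff)
  from choice[OF this] obtain p where "\<forall>n. f n = jb_poly (p n) a" by (elim exE)
  then have "f = (\<lambda>n. jb_poly (p n) a)" by (intro ext) simp
  with f show "\<exists>p. (\<lambda>n. jb_poly (p n) a) \<longlonglongrightarrow> x" by auto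
next
  assume "\<exists>p. (\<lambda>n. jb_poly (p n) a) \<longlonglongrightarrow> x"
  then show "x \<in> generated_subalgebra a"
    unfolding generated_subalgebra_def closure_sequential by (metis rangeI)
qed

lemma jb_poly_in_generated: "jb_poly p a \<in> generated_subalgebra a"
  unfolding generated_subalgebra_def by (intro subsetD[OF closure_subset] rangeI)

lemma generated_one: "1 \<in> generated_subalgebra a"
  using jb_poly_in_generated[of 1 a] by simp

lemma generated_self: "a \<in> generated_subalgebra a"
  using jb_poly_in_generated[of "[:0, 1:]" a] by simp

lemma generated_add:
  assumes "x \<in> generated_subalgebra a" "y \<in> generated_subalgebra a"
  shows "x + y \<in> generated_subalgebra a"
proof -
  from assms obtain p q where "(\<lambda>n. jb_poly (p n) a) \<longlonglongrightarrow> x" "(\<lambda>n. jb_poly (q n) a) \<longlonglongrightarrow> y"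
    by (auto simp: generated_subalgebra_iff)
  then have "(\<lambda>n. jb_poly (p n + q n) a) \<longlonglongrightarrow> x + y"
    unfolding jb_poly_add by (rule tendsto_add)
  then show ?thesis
    unfolding generated_subalgebra_iff by (rule exI[of _ "\<lambda>n. p n + q n"])
qed

lemma generated_mult:
  assumes "x \<in> generated_subalgebra a" "y \<in> generated_subalgebra a"
  shows "x * y \<in> generated_subalgebra a"
proof -
  from assms obtain p q where "(\<lambda>n. jb_poly (p n) a) \<longlonglongrightarrow> x" "(\<lambda>n. jb_poly (q n) a) \<longlonglongrightarrow> y"
    by (auto simp: generated_subalgebra_iff)
  then have "(\<lambda>n. jb_poly (p n * q n) a) \<longlonglongrightarrow> x * y"
    unfolding jb_poly_mult by (rule jb_mult.tendsto)
  then show ?thesis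
    unfolding generated_subalgebra_iff by (rule exI[of _ "\<lambda>n. p n * q n"])
qed

lemma generated_scaleR:
  assumes "x \<in> generated_subalgebra a"
  shows "c *\<^sub>R x \<in> generated_subalgebra a"
  using generated_mult[OF jb_poly_in_generated[of "[:c:]" a] assms]
  by (simp add: jordan_distribs)

lemma generated_diff:
  assumes "x \<in> generated_subalgebra a" "y \<in> generated_subalgebra a"
  shows "x - y \<in> generated_subalgebra a"
  using generated_add[OF assms(1) generated_scaleR[OF assms(2), of "-1"]] by simp

lemma generated_assoc:
  assumes "x \<in> generated_subalgebra a" "y \<in> generated_subalgebra a" "z \<in> generated_subalgebra a"
  shows "(x * y) * z = x * (y * z)"
proof -
  from assms obtain p q r where pqr: "(\<lambda>n. jb_poly (p n) a) \<longlonglongrightarrow> x"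
    "(\<lambda>n. jb_poly (q n) a) \<longlonglongrightarrow> y" "(\<lambda>n. jb_poly (r n) a) \<longlonglongrightarrow> z"
    by (auto simp: generated_subalgebra_iff)
  have "(\<lambda>n. jb_poly (p n) a * (jb_poly (q n) a * jb_poly (r n) a)) \<longlonglongrightarrow> (x * y) * z"
    using jb_mult.tendsto[OF jb_mult.tendsto[OF pqr(1,2)] pqr(3)]
    by (simp add: jb_poly_mult[symmetric] mult.assoc)
  moreover have "(\<lambda>n. jb_poly (p n) a * (jb_poly (q n) a * jb_poly (r n) a)) \<longlonglongrightarrow> x * (y * z)"
    by (intro jb_mult.tendsto pqr)
  ultimately show ?thesis by (rule LIMSEQ_unique)
qed

text \<open>
  This links Jordan inverses, which are sought in the whole algebra, to the subalgebra generated by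
  \<open>a\<close>. It gives their uniqueness, and it bounds \<open>norm g\<close> by \<open>norm b * norm (a * g)\<close>, which shows that
  a spectral value in the subalgebra is one in the whole algebra.
\<close>

lemma jb_inverse_cancels:
  assumes "jb_is_inverse a b" "g \<in> generated_subalgebra a"
  shows "b * (a * g) = g"
proof -
  have poly: "b * (a * jb_poly p a) = jb_poly p a" for p
  proof -
    have "a * jb_poly p a = (\<Sum>i\<le>degree p. coeff p i *\<^sub>R jb_power a (Suc i))"
      by (simp add: jb_poly_def jb_mult.sum_right jordan_distribs)
    then show ?thesis
      by (simp add: jb_poly_def jb_mult.sum_right jordan_distribs del: jb_power.simps)
        (simp only: jb_inverse_lowers_power[OF assms(1)])
  qed
  obtain p where p: "(\<lambda>n. jb_poly (p n) a) \<longlonglongrightarrow> g"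
    using assms(2) generated_subalgebra_iff by blast
  then have "(\<lambda>n. b * (a * jb_poly (p n) a)) \<longlonglongrightarrow> b * (a * g)"
    by (intro jb_mult.tendsto tendsto_const)
  with p show ?thesis unfolding poly by (rule LIMSEQ_unique[rotated])
qed

text \<open>Depending on @\<close>

lemma jb_inverse_eqI:
  assumes "g \<in> generated_subalgebra a" "a * g = 1"
  shows "jb_is_inverse a g" "jb_inverse a = g"
proof -
  show inv: "jb_is_inverse a g"
    unfolding jb_is_inverse_def
    using assms generated_assoc[OF generated_self generated_self assms(1)] by simp
  show "jb_inverse a = g" unfolding jb_inverse_def
  proof (rule the_equality)
    show "jb_is_inverse a g" by (rule inv)
  next
    fix b assume "jb_is_inverse a b"
    from jb_inverse_cancels[OF this assms(1)] assms(2) show "b = g" by simp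
  qed
qed

section \<open>Positive polynomials at an element are squares\<close>

text \<open>
  The equation \<open>1 - a = (1 - y) (1 - y)\<close> reads \<open>y = (a + y y)/2\<close>. On the ball of radius \<open>norm a\<close> the
  right-hand side is a contraction with constant \<open>norm a\<close>, because
  \<open>y y - z z = (y + z) (y - z)\<close> in any commutative algebra, associative or not.
\<close>

lemma square_root_near_one:
  assumes a: "a \<in> generated_subalgebra x" and n: "norm a < 1"
  shows "\<exists>s\<in>generated_subalgebra x. 1 - a = s * s"
proof -
  let ?S = "generated_subalgebra x \<inter> cball 0 (norm a)"
  let ?f = "\<lambda>y. (1/2) *\<^sub>R (a + y * y)"
  have "\<exists>!y\<in>?S. ?f y = y"
  proof (rule Banach_fix)
    show "complete ?S"
      by (auto simp: generated_subalgebra_def complete_eq_closed)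
    show "?S \<noteq> {}" using a by auto
    show "?f ` ?S \<subseteq> ?S"
    proof (rule image_subsetI)
      fix y assume "y \<in> ?S"
      then have y: "y \<in> generated_subalgebra x" "norm y \<le> norm a" by auto
      have "norm (a + y * y) \<le> norm a + norm y * norm y"
        by (rule order_trans[OF norm_triangle_ineq]) (simp add: jb_norm_mult)
      also have "norm y * norm y \<le> norm a * 1"
        using y n by (intro mult_mono) auto
      finally show "?f y \<in> ?S"
        using a y by (auto intro!: generated_scaleR generated_add generated_mult)
    qed
    show "dist (?f y) (?f z) \<le> norm a * dist y z" if "y \<in> ?S" "z \<in> ?S" for y z
    proof -
      from that have yz: "norm y \<le> norm a" "norm z \<le> norm a" by auto
      have "?f y - ?f z = (1/2) *\<^sub>R ((y + z) * (y - z))"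
        by (simp add: jordan_distribs jordan_commute[of z y] algebra_simps)
      then have "dist (?f y) (?f z) = 1/2 * norm ((y + z) * (y - z))"
        by (simp add: dist_norm)
      also have "norm ((y + z) * (y - z)) \<le> (2 * norm a) * norm (y - z)"
        using yz norm_triangle_ineq[of y z]
        by (intro order_trans[OF jb_norm_mult] mult_right_mono) auto
      finally show "dist (?f y) (?f z) \<le> norm a * dist y z"
        by (simp add: dist_norm)
    qed
  qed (use n in auto)
  then obtain y where y: "y \<in> generated_subalgebra x" "(1/2) *\<^sub>R (a + y * y) = y" by auto
  have "a + y * y = y + y"
    using arg_cong[OF y(2), of "\<lambda>u. 2 *\<^sub>R u"] by (simp add: scaleR_2)
  then have "1 - a = (1 - y) * (1 - y)"
    by (simp add: jordan_distribs algebra_simps)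
  moreover have "1 - y \<in> generated_subalgebra x"
    using y generated_one generated_diff by blast
  ultimately show ?thesis by blast
qed

text \<open>
  Positivity expressed by the norm: in an algebra of continuous functions, \<open>norm (t - a) < t\<close> for
  some \<open>t\<close> says that \<open>a\<close> is bounded below by a positive constant. In this form it yields square
  roots at once and is stable under small perturbations.
\<close>

definition strictly_positive_in :: "'a::unital_jb_algebra \<Rightarrow> 'a set" where
  "strictly_positive_in x = {a \<in> generated_subalgebra x. \<exists>t. norm (t *\<^sub>R 1 - a) < t}"

lemma strictly_positive_square_root:
  assumes "a \<in> strictly_positive_in x"
  shows "\<exists>s\<in>generated_subalgebra x. a = s * s"
proof -
  from assms obtain t where t: "a \<in> generated_subalgebra x" "norm (t *\<^sub>R 1 - a) < t"
    by (auto simp: strictly_positive_in_def)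
  from t(2) have pos: "t > 0" using norm_ge_zero[of "t *\<^sub>R 1 - a"] by linarith
  have "(1 / t) *\<^sub>R (t *\<^sub>R 1 - a) \<in> generated_subalgebra x"
    using t by (intro generated_scaleR generated_diff generated_one)
  moreover have "norm ((1 / t) *\<^sub>R (t *\<^sub>R 1 - a)) < 1"
    using t pos by (simp only: norm_scaleR) (simp add: divide_simps)
  ultimately obtain s where s: "s \<in> generated_subalgebra x" "1 - (1 / t) *\<^sub>R (t *\<^sub>R 1 - a) = s * s"
    using square_root_near_one by blast
  have "a = (sqrt t *\<^sub>R s) * (sqrt t *\<^sub>R s)"
    using pos by (simp add: jordan_distribs s(2)[symmetric] scaleR_diff_right)
  then show ?thesis using s generated_scaleR by blast
qed

text \<open>
  After scaling to \<open>norm b < 1\<close>, the element \<open>1 - b b\<close> is itself a square \<open>s s\<close>, and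
  \<open>norm (s s) \<le> norm (s s + b b) = norm 1\<close>. This is where the order axiom of the norm turns squares
  into positive elements.
\<close>

lemma norm_scale_one_minus_square:
  assumes b: "b \<in> generated_subalgebra x" "norm b < r"
  shows "norm ((r * r) *\<^sub>R 1 - b * b) \<le> r * r"
proof -
  have r: "r > 0" using b norm_ge_zero[of b] by linarith
  have "(1/r) *\<^sub>R b \<in> generated_subalgebra x" using b generated_scaleR by blast
  then have "((1/r) *\<^sub>R b) * ((1/r) *\<^sub>R b) \<in> generated_subalgebra x" by (intro generated_mult)
  moreover have "norm (((1/r) *\<^sub>R b) * ((1/r) *\<^sub>R b)) < 1"
    using b r by (subst jb_norm_square) (auto simp: abs_square_less_1)
  ultimately obtain s where s: "1 - ((1/r) *\<^sub>R b) * ((1/r) *\<^sub>R b) = s * s"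
    using square_root_near_one by blast
  have "norm (s * s) \<le> norm (s * s + ((1/r) *\<^sub>R b) * ((1/r) *\<^sub>R b))"
    by (rule jb_norm_square_add)
  also have "\<dots> \<le> 1" using norm_jb_one_le by (simp add: s[symmetric])
  finally have "norm (s * s) \<le> 1" .
  have "(r * r) *\<^sub>R 1 - b * b = (r * r) *\<^sub>R (s * s)"
    using r by (simp add: s[symmetric] jordan_distribs scaleR_diff_right)
  then have "norm ((r * r) *\<^sub>R 1 - b * b) = (r * r) * norm (s * s)" using r by simp
  also have "\<dots> \<le> (r * r) * 1"
    using \<open>norm (s * s) \<le> 1\<close> r by (intro mult_left_mono) auto
  finally show ?thesis by simp
qed

lemma square_weakly_positive:
  assumes "b \<in> generated_subalgebra x"
  shows "\<exists>t. norm (t *\<^sub>R 1 - b * b) \<le> t"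
  using norm_scale_one_minus_square[OF assms, of "norm b + 1"] by auto

text \<open>
  Subtract a small multiple \<open>e\<close> of the unit from both factors, so that \<open>a = b b + e\<close> and
  \<open>c = d d + e\<close>. The product is then a sum of the squares \<open>(b d) (b d)\<close>, \<open>b b\<close>, \<open>d d\<close> with nonnegative
  coefficients plus \<open>e e\<close>, and the last term makes it strictly positive.
\<close>

lemma strictly_positive_mult:
  assumes "a \<in> strictly_positive_in x" "c \<in> strictly_positive_in x"
  shows "a * c \<in> strictly_positive_in x"
proof -
  obtain t u where tu: "a \<in> generated_subalgebra x" "norm (t *\<^sub>R 1 - a) < t"
      "c \<in> generated_subalgebra x" "norm (u *\<^sub>R 1 - c) < u"
    using assms by (auto simp: strictly_positive_in_def)
  define e where "e = min (t - norm (t *\<^sub>R 1 - a)) (u - norm (u *\<^sub>R 1 - c)) / 2"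
  have e: "e > 0" "norm (t *\<^sub>R 1 - a) < t - e" "norm (u *\<^sub>R 1 - c) < u - e"
    using tu by (auto simp: e_def min_def field_simps)
  have shrink: "z - e *\<^sub>R 1 \<in> strictly_positive_in x"
    if "z \<in> generated_subalgebra x" "norm (s *\<^sub>R 1 - z) < s - e" for z s
    using that generated_one[of x]
    by (auto simp: strictly_positive_in_def algebra_simps
        intro!: generated_diff generated_scaleR exI[of _ "s - e"])
  have "a - e *\<^sub>R 1 \<in> strictly_positive_in x" "c - e *\<^sub>R 1 \<in> strictly_positive_in x"
    by (rule shrink[OF tu(1) e(2)], rule shrink[OF tu(3) e(3)])
  then obtain b d where bd: "b \<in> generated_subalgebra x" "a - e *\<^sub>R 1 = b * b"
      "d \<in> generated_subalgebra x" "c - e *\<^sub>R 1 = d * d"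
    using strictly_positive_square_root by metis
  have swap: "(b * b) * (d * d) = (b * d) * (b * d)"
  proof -
    have bdd: "b * d \<in> generated_subalgebra x" "d * d \<in> generated_subalgebra x"
      using bd generated_mult by auto
    have "(b * b) * (d * d) = b * (b * (d * d))"
      by (rule generated_assoc[OF bd(1,1) bdd(2)])
    also have "b * (d * d) = d * (b * d)"
      using generated_assoc[OF bd(1,3,3)] by (simp add: jordan_commute)
    also have "b * (d * (b * d)) = (b * d) * (b * d)"
      by (rule generated_assoc[OF bd(1,3) bdd(1), symmetric])
    finally show ?thesis .
  qed
  have ac: "a * c = (b * d) * (b * d) + e *\<^sub>R (b * b) + e *\<^sub>R (d * d) + (e * e) *\<^sub>R 1"
  proof -
    have "a = b * b + e *\<^sub>R 1" "c = d * d + e *\<^sub>R 1" using bd by (simp_all add: algebra_simps)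
    then show ?thesis by (simp add: jordan_distribs swap algebra_simps)
  qed
  obtain t1 t2 t3 where t: "norm (t1 *\<^sub>R 1 - (b * d) * (b * d)) \<le> t1"
      "norm (t2 *\<^sub>R 1 - b * b) \<le> t2" "norm (t3 *\<^sub>R 1 - d * d) \<le> t3"
    using square_weakly_positive[OF generated_mult[OF bd(1,3)]]
      square_weakly_positive[OF bd(1)] square_weakly_positive[OF bd(3)] by (elim exE) auto
  have "(t1 + e * t2 + e * t3 + e * e) *\<^sub>R 1 - a * c
      = (t1 *\<^sub>R 1 - (b * d) * (b * d)) + e *\<^sub>R (t2 *\<^sub>R 1 - b * b) + e *\<^sub>R (t3 *\<^sub>R 1 - d * d)"
    unfolding ac by (simp add: algebra_simps)
  also have "norm \<dots> \<le> norm (t1 *\<^sub>R 1 - (b * d) * (b * d)) + norm (e *\<^sub>R (t2 *\<^sub>R 1 - b * b))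
      + norm (e *\<^sub>R (t3 *\<^sub>R 1 - d * d))"
    by (intro norm_triangle_le add_mono) auto
  also have "\<dots> \<le> t1 + e * t2 + e * t3"
    using t e by (auto intro!: add_mono)
  also have "\<dots> < t1 + e * t2 + e * t3 + e * e" using e by simp
  finally have "norm ((t1 + e * t2 + e * t3 + e * e) *\<^sub>R 1 - a * c) < \<dots>" .
  then show ?thesis
    unfolding strictly_positive_in_def using tu generated_mult by blast
qed

lemma strictly_positive_const:
  "c > 0 \<Longrightarrow> c *\<^sub>R 1 \<in> strictly_positive_in x"
  by (auto simp: strictly_positive_in_def intro!: generated_scaleR generated_one exI[of _ c])

lemma strictly_positive_linear:
  assumes "norm a < r"
  shows "r *\<^sub>R 1 - a \<in> strictly_positive_in a" "r *\<^sub>R 1 + a \<in> strictly_positive_in a"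
  using assms generated_one[of a] generated_self[of a]
  by (auto simp: strictly_positive_in_def
      intro!: generated_diff generated_add generated_scaleR exI[of _ r])

lemma strictly_positive_quadratic:
  assumes "v \<noteq> 0"
  shows "(a - u *\<^sub>R 1) * (a - u *\<^sub>R 1) + (v * v) *\<^sub>R 1 \<in> strictly_positive_in a"
proof -
  have g: "a - u *\<^sub>R 1 \<in> generated_subalgebra a"
    by (intro generated_diff generated_scaleR generated_one generated_self)
  obtain t where t: "norm (t *\<^sub>R 1 - (a - u *\<^sub>R 1) * (a - u *\<^sub>R 1)) \<le> t"
    using square_weakly_positive[OF g] by blast
  have eq: "(t + v * v) *\<^sub>R 1 - ((a - u *\<^sub>R 1) * (a - u *\<^sub>R 1) + (v * v) *\<^sub>R 1)
     = t *\<^sub>R 1 - (a - u *\<^sub>R 1) * (a - u *\<^sub>R 1)"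
    by (simp add: algebra_simps)
  have "norm ((t + v * v) *\<^sub>R 1 - ((a - u *\<^sub>R 1) * (a - u *\<^sub>R 1) + (v * v) *\<^sub>R 1)) \<le> t"
    unfolding eq by (rule t)
  moreover have "v * v > 0" using assms by (simp add: zero_less_mult_iff) linarith
  ultimately show ?thesis using t g generated_one[of a]
    by (auto simp: strictly_positive_in_def
        intro!: generated_add generated_mult generated_scaleR exI[of _ "t + v * v"])
qed

lemma map_poly_of_real_mult:
  "map_poly complex_of_real (p * q) = map_poly complex_of_real p * map_poly complex_of_real q"
  by (intro poly_eqI) (simp add: coeff_map_poly coeff_mult)

lemma map_poly_of_real_add:
  "map_poly complex_of_real (p + q) = map_poly complex_of_real p + map_poly complex_of_real q"
  by (intro poly_eqI) (simp add: coeff_map_poly)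

text \<open>
  The quadratic is \<open>(x - Re z)\<^sup>2 + (Im z)\<^sup>2\<close>. The remainder of \<open>q\<close> modulo it is a real linear polynomial
  that vanishes at the nonreal number \<open>z\<close>, hence is zero.
\<close>

lemma real_poly_quadratic_factor:
  fixes q :: "real poly"
  assumes root: "poly (map_poly complex_of_real q) z = 0" and "Im z \<noteq> 0"
  shows "([:- Re z, 1:] * [:- Re z, 1:] + [:Im z * Im z:]) dvd q"
proof -
  define d where "d = [:- Re z, 1:] * [:- Re z, 1:] + [:Im z * Im z:]"
  have deg: "degree d = 2" "d \<noteq> 0" by (auto simp: d_def)
  have dz: "poly (map_poly complex_of_real d) z = 0"
    by (simp add: d_def map_poly_pCons complex_eq_iff algebra_simps)
  have "q = q div d * d + q mod d" by simp
  then have "poly (map_poly complex_of_real (q mod d)) z = 0"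
    using root dz by (metis add_0 map_poly_of_real_add map_poly_of_real_mult mult_zero_right poly_add poly_mult)
  moreover have "degree (q mod d) < 2"
    using degree_mod_less'[of d q] deg by (cases "q mod d = 0") auto
  then have "q mod d = [:coeff (q mod d) 0, coeff (q mod d) 1:]"
    by (intro poly_eqI) (auto simp: coeff_pCons coeff_eq_0 split: nat.split)
  then obtain b c where bc: "q mod d = [:b, c:]" by blast
  ultimately have "complex_of_real b + z * complex_of_real c = 0"
    by (simp add: map_poly_pCons)
  then have "c = 0" "b = 0" using assms(2) by (auto simp: complex_eq_iff)
  then have "q mod d = 0" using bc by simp
  then show ?thesis unfolding d_def[symmetric] by (simp add: dvd_eq_mod_eq_0)
qed

lemma positive_poly_factor_positive:
  assumes "\<forall>x. \<bar>x\<bar> \<le> R \<longrightarrow> 0 < poly d x" "\<forall>x. \<bar>x\<bar> \<le> R \<longrightarrow> 0 < poly (d * k) x"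
  shows "\<forall>x. \<bar>x\<bar> \<le> (R::real) \<longrightarrow> 0 < poly k x"
  using assms by (metis poly_mult zero_less_mult_pos)

text \<open>
  Induction on the degree. A complex root of \<open>q\<close> splits off a real factor that is positive on
  \<open>[-R, R]\<close>: a quadratic that is strictly positive everywhere if the root is not real, and \<open>r - x\<close>
  or \<open>x - r\<close> if it is a real \<open>r\<close>, which must lie outside \<open>[-R, R]\<close>. The cofactor is again positive on
  the interval, and strictly positive elements are closed under products.
\<close>

lemma positive_poly_strictly_positive:
  fixes a :: "'a::unital_jb_algebra"
  assumes "norm a < R" and "\<forall>x. \<bar>x\<bar> \<le> R \<longrightarrow> 0 < poly q x"
  shows "jb_poly q a \<in> strictly_positive_in a"
  using assms(2)
proof (induction "degree q" arbitrary: q rule: less_induct)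
  case less
  have R: "R > 0" using assms(1) norm_ge_zero[of a] by linarith
  then have "q \<noteq> 0" using less.prems by (auto dest!: spec[of _ 0])
  have factor: "jb_poly q a \<in> strictly_positive_in a"
    if q: "q = d * k" and d: "\<forall>x. \<bar>x\<bar> \<le> R \<longrightarrow> 0 < poly d x" "degree d > 0"
      "jb_poly d a \<in> strictly_positive_in a" for d k
  proof -
    have k: "\<forall>x. \<bar>x\<bar> \<le> R \<longrightarrow> 0 < poly k x"
      by (rule positive_poly_factor_positive[OF d(1)]) (use less.prems q in simp)
    have "degree k < degree q"
      using q d(2) \<open>q \<noteq> 0\<close> by (auto simp: degree_mult_eq)
    then have "jb_poly k a \<in> strictly_positive_in a" using k by (rule less.hyps)
    then show ?thesis unfolding q jb_poly_mult by (rule strictly_positive_mult[OF d(3)])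
  qed
  show ?case
  proof (cases "degree q = 0")
    case True
    then obtain c where "q = [:c:]" by (metis degree_eq_zeroE)
    moreover have "c > 0" using less.prems \<open>q = [:c:]\<close> R by (auto dest!: spec[of _ 0])
    ultimately show ?thesis by (simp add: strictly_positive_const)
  next
    case False
    have "\<not> constant (poly (map_poly complex_of_real q))"
      using False by (simp add: constant_degree degree_map_poly)
    then obtain z where z: "poly (map_poly complex_of_real q) z = 0"
      using fundamental_theorem_of_algebra by blast
    show ?thesis
    proof (cases "Im z = 0")
      case True
      define r where "r = Re z"
      have "z = complex_of_real r" using True by (simp add: complex_eq_iff r_def)
      with z have "complex_of_real (poly q r) = 0"
        by (simp add: poly_altdef degree_map_poly coeff_map_poly)
      then have root: "poly q r = 0" by simp
      then have "\<not> \<bar>r\<bar> \<le> R" using less.prems by (metis less_irrefl)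
      then consider "r > R" | "- r > R" by linarith
      then show ?thesis
      proof cases
        case 1
        have "[:- r, 1:] dvd q" using root by (simp add: poly_eq_0_iff_dvd)
        then obtain k where "q = [:- r, 1:] * k" by (elim dvdE)
        then have "q = [:r, -1:] * (- k)" by simp
        then show ?thesis
          by (rule factor) (use 1 assms(1) strictly_positive_linear(1)[of a r] in auto)
      next
        case 2
        have "[:- r, 1:] dvd q" using root by (simp add: poly_eq_0_iff_dvd)
        then obtain k where "q = [:- r, 1:] * k" by (elim dvdE)
        then show ?thesis
          by (rule factor) (use 2 assms(1) strictly_positive_linear(2)[of a "- r"] in auto)
      qed
    next
      case False
      let ?d = "[:- Re z, 1:] * [:- Re z, 1:] + [:Im z * Im z:]"
      have "?d dvd q" using real_poly_quadratic_factor[OF z False] .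
      then obtain k where "q = ?d * k" by (elim dvdE)
      then show ?thesis
      proof (rule factor)
        show "\<forall>x. \<bar>x\<bar> \<le> R \<longrightarrow> 0 < poly ?d x"
        proof (intro allI impI)
          fix x
          have "poly ?d x = (x - Re z) * (x - Re z) + Im z * Im z" by (simp add: algebra_simps)
          also have "\<dots> > 0" using False by (intro add_nonneg_pos) (auto simp: zero_less_mult_iff)
          finally show "0 < poly ?d x" .
        qed
        show "0 < degree ?d" by simp
        have "jb_poly ?d a = (a - Re z *\<^sub>R 1) * (a - Re z *\<^sub>R 1) + (Im z * Im z) *\<^sub>R 1"
          by (simp only: jb_poly_add jb_poly_mult jb_poly_const jb_poly_linear) (simp add: algebra_simps)
        then show "jb_poly ?d a \<in> strictly_positive_in a"
          using strictly_positive_quadratic[OF False, of a "Re z"] by metis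
      qed
    qed
  qed
qed

text \<open>
  The polynomial \<open>c\<^sup>2 + e - q\<^sup>2\<close> is positive on the interval, so its value at \<open>a\<close> is a square \<open>s s\<close> and
  \<open>norm (q(a) q(a)) \<le> norm (q(a) q(a) + s s) \<le> c\<^sup>2 + e\<close>. The slack \<open>e\<close> provides the strict positivity.
\<close>

lemma norm_jb_poly_le:
  fixes a :: "'a::unital_jb_algebra"
  assumes "norm a < R" and bound: "\<forall>x. \<bar>x\<bar> \<le> R \<longrightarrow> \<bar>poly q x\<bar> \<le> c"
  shows "norm (jb_poly q a) \<le> c"
proof -
  have R: "R > 0" using assms(1) norm_ge_zero[of a] by linarith
  then have "c \<ge> 0" using bound[rule_format, of 0] by auto
  have "(norm (jb_poly q a))\<^sup>2 \<le> c\<^sup>2 + e" if "e > 0" for e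
  proof -
    have "0 < poly ([:c\<^sup>2 + e:] - q * q) x" if "\<bar>x\<bar> \<le> R" for x
    proof -
      have "(poly q x)\<^sup>2 \<le> c\<^sup>2" using bound that \<open>c \<ge> 0\<close> by (metis abs_le_square_iff abs_of_nonneg)
      then show ?thesis using \<open>e > 0\<close> by (simp add: power2_eq_square)
    qed
    then have "jb_poly ([:c\<^sup>2 + e:] - q * q) a \<in> strictly_positive_in a"
      using positive_poly_strictly_positive[OF assms(1)] by blast
    then obtain s where "jb_poly ([:c\<^sup>2 + e:] - q * q) a = s * s"
      using strictly_positive_square_root by blast
    then have s: "jb_poly q a * jb_poly q a + s * s = (c\<^sup>2 + e) *\<^sub>R 1"
      by (simp add: jb_poly_diff jb_poly_mult algebra_simps)
    have "(norm (jb_poly q a))\<^sup>2 = norm (jb_poly q a * jb_poly q a)" by (simp add: jb_norm_square)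
    also have "\<dots> \<le> norm ((c\<^sup>2 + e) *\<^sub>R (1::'a))"
      using jb_norm_square_add[of "jb_poly q a" s] unfolding s .
    also have "\<dots> \<le> (c\<^sup>2 + e) * 1"
      using norm_jb_one_le \<open>e > 0\<close> unfolding norm_scaleR by (intro mult_mono) auto
    finally show ?thesis by simp
  qed
  then have "(norm (jb_poly q a))\<^sup>2 \<le> c\<^sup>2" by (rule field_le_epsilon)
  then show ?thesis using \<open>c \<ge> 0\<close> by (rule power2_le_imp_le)
qed

section \<open>Extension to continuous functions\<close>

text \<open>
  The strict inequality \<open>R > norm a\<close> in \<open>norm_jb_poly_le\<close> is the reason for the added \<open>1\<close>.
\<close>

definition calculus_interval :: "'a::unital_jb_algebra \<Rightarrow> real set" where
  "calculus_interval a = {- (norm a + 1)..norm a + 1}"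

lemma calculus_interval_iff: "x \<in> calculus_interval a \<longleftrightarrow> \<bar>x\<bar> \<le> norm a + 1"
  by (auto simp: calculus_interval_def)

lemma compact_calculus_interval: "compact (calculus_interval a)"
  by (simp add: calculus_interval_def)

definition poly_limit :: "'a::unital_jb_algebra \<Rightarrow> (real \<Rightarrow> real) \<Rightarrow> 'a \<Rightarrow> bool" where
  "poly_limit a f y \<longleftrightarrow> (\<exists>p. uniform_limit (calculus_interval a) (\<lambda>n. poly (p n)) f sequentially
     \<and> (\<lambda>n. jb_poly (p n) a) \<longlonglongrightarrow> y)"

lemma poly_fun_eqs:
  "poly (p + q) = (\<lambda>x. poly p x + poly q x)"
  "poly (p * q) = (\<lambda>x. poly p x * poly q x)"
  "poly (smult c p) = (\<lambda>x. c * poly p x)"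
  "poly [:c:] = (\<lambda>x. c)"
  "poly [:- r, 1:] = (\<lambda>x. x - r)" for p q :: "real poly" and c r :: real
  by (simp_all add: fun_eq_iff)

lemma norm_jb_poly_le_interval:
  assumes "\<forall>x\<in>calculus_interval a. \<bar>poly q x\<bar> \<le> c"
  shows "norm (jb_poly q a) \<le> c"
  by (rule norm_jb_poly_le[of a "norm a + 1"]) (use assms in \<open>auto simp: calculus_interval_iff\<close>)

lemma norm_poly_limit_le:
  assumes "poly_limit a f y" and bound: "\<forall>x\<in>calculus_interval a. \<bar>f x\<bar> \<le> c"
  shows "norm y \<le> c"
proof (rule field_le_epsilon)
  fix e :: real assume "e > 0"
  from assms obtain p where p: "uniform_limit (calculus_interval a) (\<lambda>n. poly (p n)) f sequentially"
    "(\<lambda>n. jb_poly (p n) a) \<longlonglongrightarrow> y" by (auto simp: poly_limit_def)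
  from uniform_limitD[OF p(1) \<open>e > 0\<close>]
  have "\<forall>\<^sub>F n in sequentially. norm (jb_poly (p n) a) \<le> c + e"
  proof eventually_elim
    case (elim n)
    have "\<bar>poly (p n) x\<bar> \<le> c + e" if "x \<in> calculus_interval a" for x
      using elim[rule_format, OF that] bound[rule_format, OF that] by (auto simp: dist_real_def)
    then show ?case by (intro norm_jb_poly_le_interval) blast
  qed
  with p(2) show "norm y \<le> c + e" by (intro Lim_norm_ubound) auto
qed

lemma poly_limit_add:
  assumes "poly_limit a f y" "poly_limit a g z"
  shows "poly_limit a (\<lambda>x. f x + g x) (y + z)"
proof -
  from assms obtain p q where p: "uniform_limit (calculus_interval a) (\<lambda>n. poly (p n)) f sequentially"
      "(\<lambda>n. jb_poly (p n) a) \<longlonglongrightarrow> y"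
    and q: "uniform_limit (calculus_interval a) (\<lambda>n. poly (q n)) g sequentially"
      "(\<lambda>n. jb_poly (q n) a) \<longlonglongrightarrow> z" by (auto simp: poly_limit_def)
  show ?thesis unfolding poly_limit_def
    using uniform_limit_add[OF p(1) q(1)] tendsto_add[OF p(2) q(2)]
    by (intro exI[of _ "\<lambda>n. p n + q n"]) (simp add: jb_poly_add poly_fun_eqs)
qed

lemma poly_limit_mult:
  assumes "poly_limit a f y" "poly_limit a g z"
    and "continuous_on (calculus_interval a) f" "continuous_on (calculus_interval a) g"
  shows "poly_limit a (\<lambda>x. f x * g x) (y * z)"
proof -
  from assms obtain p q where p: "uniform_limit (calculus_interval a) (\<lambda>n. poly (p n)) f sequentially"
      "(\<lambda>n. jb_poly (p n) a) \<longlonglongrightarrow> y"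
    and q: "uniform_limit (calculus_interval a) (\<lambda>n. poly (q n)) g sequentially"
      "(\<lambda>n. jb_poly (q n) a) \<longlonglongrightarrow> z" by (auto simp: poly_limit_def)
  have "bounded (f ` calculus_interval a)" "bounded (g ` calculus_interval a)"
    using assms compact_calculus_interval by (auto intro!: compact_imp_bounded compact_continuous_image)
  then have "uniform_limit (calculus_interval a) (\<lambda>n x. poly (p n) x * poly (q n) x) (\<lambda>x. f x * g x) sequentially"
    by (intro bounded_bilinear.bounded_uniform_limit[OF bounded_bilinear_mult] p q)
  then show ?thesis unfolding poly_limit_def
    using jb_mult.tendsto[OF p(2) q(2)]
    by (intro exI[of _ "\<lambda>n. p n * q n"]) (simp add: jb_poly_mult poly_fun_eqs)
qed

lemma poly_limit_poly: "poly_limit a (poly q) (jb_poly q a)"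
  unfolding poly_limit_def by (intro exI[of _ "\<lambda>n. q"]) (simp add: uniform_limit_const)

lemma poly_limit_scale:
  assumes "poly_limit a f y"
  shows "poly_limit a (\<lambda>x. c * f x) (c *\<^sub>R y)"
proof -
  from assms obtain p where p: "uniform_limit (calculus_interval a) (\<lambda>n. poly (p n)) f sequentially"
      "(\<lambda>n. jb_poly (p n) a) \<longlonglongrightarrow> y" by (auto simp: poly_limit_def)
  have "uniform_limit (calculus_interval a) (\<lambda>n x. c * poly (p n) x) (\<lambda>x. c * f x) sequentially"
    by (rule bounded_linear.uniform_limit[OF bounded_linear_mult_right p(1)])
  then show ?thesis unfolding poly_limit_def
    using tendsto_scaleR[OF tendsto_const p(2)]
    by (intro exI[of _ "\<lambda>n. smult c (p n)"]) (simp add: jb_poly_smult poly_fun_eqs)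
qed

lemma ex_poly_approximation:
  fixes f :: "real \<Rightarrow> real"
  assumes "continuous_on (calculus_interval a) f" "e > 0"
  shows "\<exists>p. \<forall>x\<in>calculus_interval a. \<bar>f x - poly p x\<bar> < e"
proof -
  obtain g where g: "real_polynomial_function g" "\<And>x. x \<in> calculus_interval a \<Longrightarrow> \<bar>f x - g x\<bar> < e"
    using Stone_Weierstrass_real_polynomial_function[OF compact_calculus_interval assms] by blast
  then obtain c n where "g = (\<lambda>x. \<Sum>i\<le>n. c i * x ^ i)"
    using real_polynomial_function_iff_sum by blast
  then have "g = poly (\<Sum>i\<le>n. monom (c i) i)" by (simp add: poly_sum poly_monom fun_eq_iff)
  with g(2) show ?thesis by blast
qed

text \<open>
  Uniformly convergent polynomials on the interval have a Cauchy sequence of values at \<open>a\<close>, by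
  \<open>norm_jb_poly_le\<close> applied to their differences.
\<close>

lemma ex_poly_limit:
  assumes "continuous_on (calculus_interval a) f"
  shows "\<exists>y. poly_limit a f y"
proof -
  have "\<forall>n. \<exists>p. \<forall>x\<in>calculus_interval a. \<bar>f x - poly p x\<bar> < inverse (real (Suc n))"
    using ex_poly_approximation[OF assms] by simp
  from choice[OF this] obtain p where
    p: "\<And>n x. x \<in> calculus_interval a \<Longrightarrow> \<bar>f x - poly (p n) x\<bar> < inverse (real (Suc n))" by auto
  have unif: "uniform_limit (calculus_interval a) (\<lambda>n. poly (p n)) f sequentially"
  proof (rule uniform_limitI)
    fix e :: real assume "e > 0"
    have "\<forall>\<^sub>F n in sequentially. inverse (real (Suc n)) < e"
      using LIMSEQ_inverse_real_of_nat order_tendstoD(2)[of _ 0 sequentially e] \<open>e > 0\<close> by auto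
    then show "\<forall>\<^sub>F n in sequentially. \<forall>x\<in>calculus_interval a. dist (poly (p n) x) (f x) < e"
      by eventually_elim (use p in \<open>fastforce simp: dist_real_def abs_minus_commute intro: less_trans\<close>)
  qed
  have "Cauchy (\<lambda>n. jb_poly (p n) a)"
  proof (rule metric_CauchyI)
    fix e :: real assume "e > 0"
    have "uniformly_Cauchy_on (calculus_interval a) (\<lambda>n. poly (p n))"
      using unif uniformly_convergent_eq_Cauchy uniformly_convergent_on_def by blast
    then obtain M where M: "\<forall>x\<in>calculus_interval a. \<forall>m\<ge>M. \<forall>n\<ge>M. dist (poly (p m) x) (poly (p n) x) < e / 2"
      using \<open>e > 0\<close> unfolding uniformly_Cauchy_on_def by (meson half_gt_zero)
    show "\<exists>M. \<forall>m\<ge>M. \<forall>n\<ge>M. dist (jb_poly (p m) a) (jb_poly (p n) a) < e"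
    proof (intro exI allI impI)
      fix m n assume "M \<le> m" "M \<le> n"
      then have "norm (jb_poly (p m - p n) a) \<le> e / 2"
        using M by (intro norm_jb_poly_le_interval) (auto simp: dist_real_def intro: less_imp_le)
      then show "dist (jb_poly (p m) a) (jb_poly (p n) a) < e"
        using \<open>e > 0\<close> by (simp add: dist_norm jb_poly_diff)
    qed
  qed
  then obtain y where "(\<lambda>n. jb_poly (p n) a) \<longlonglongrightarrow> y" using Cauchy_convergent convergent_def by blast
  with unif show ?thesis unfolding poly_limit_def by blast
qed

lemma poly_limit_unique:
  assumes "poly_limit a f y" "poly_limit a g z" "\<forall>x\<in>calculus_interval a. f x = g x"
  shows "y = z"
proof -
  have "norm (y + (-1) *\<^sub>R z) \<le> 0"
    by (rule norm_poly_limit_le[OF poly_limit_add[OF assms(1) poly_limit_scale[OF assms(2), of "-1"]]])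
      (use assms(3) in simp)
  then show ?thesis by simp
qed

definition interval_calculus :: "'a::unital_jb_algebra \<Rightarrow> (real \<Rightarrow> real) \<Rightarrow> 'a" where
  "interval_calculus a f = (THE y. poly_limit a f y)"

lemma interval_calculus_eqI: "poly_limit a f y \<Longrightarrow> interval_calculus a f = y"
  unfolding interval_calculus_def by (rule the_equality) (auto intro: poly_limit_unique)

lemma interval_calculus_limit:
  "continuous_on (calculus_interval a) f \<Longrightarrow> poly_limit a f (interval_calculus a f)"
  using ex_poly_limit interval_calculus_eqI by metis

lemma interval_calculus_add:
  assumes "continuous_on (calculus_interval a) f" "continuous_on (calculus_interval a) g"
  shows "interval_calculus a (\<lambda>x. f x + g x) = interval_calculus a f + interval_calculus a g"
  using assms by (intro interval_calculus_eqI poly_limit_add interval_calculus_limit)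

lemma interval_calculus_mult:
  assumes "continuous_on (calculus_interval a) f" "continuous_on (calculus_interval a) g"
  shows "interval_calculus a (\<lambda>x. f x * g x) = interval_calculus a f * interval_calculus a g"
  using assms by (intro interval_calculus_eqI poly_limit_mult interval_calculus_limit)

lemma interval_calculus_scale:
  assumes "continuous_on (calculus_interval a) f"
  shows "interval_calculus a (\<lambda>x. c * f x) = c *\<^sub>R interval_calculus a f"
  using assms by (intro interval_calculus_eqI poly_limit_scale interval_calculus_limit)

lemma interval_calculus_diff:
  assumes "continuous_on (calculus_interval a) f" "continuous_on (calculus_interval a) g"
  shows "interval_calculus a (\<lambda>x. f x - g x) = interval_calculus a f - interval_calculus a g"
proof -
  have "interval_calculus a (\<lambda>x. f x + (-1) * g x) = interval_calculus a f + interval_calculus a (\<lambda>x. (-1) * g x)"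
    by (rule interval_calculus_add) (use assms in \<open>auto intro!: continuous_intros\<close>)
  then show ?thesis using interval_calculus_scale[OF assms(2), of "-1"] by simp
qed

lemma interval_calculus_poly: "interval_calculus a (poly q) = jb_poly q a"
  by (intro interval_calculus_eqI poly_limit_poly)

lemma interval_calculus_const: "interval_calculus a (\<lambda>x. c) = c *\<^sub>R 1"
  using interval_calculus_poly[of a "[:c:]"] by (simp only: poly_fun_eqs jb_poly_const)

lemma interval_calculus_shift: "interval_calculus a (\<lambda>x. x - r) = a - r *\<^sub>R 1"
  using interval_calculus_poly[of a "[:-r, 1:]"]
  by (simp only: poly_fun_eqs jb_poly_linear) simp

lemma interval_calculus_cong:
  assumes "continuous_on (calculus_interval a) f" "\<forall>x\<in>calculus_interval a. f x = g x"
  shows "interval_calculus a f = interval_calculus a g"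
proof -
  have "continuous_on (calculus_interval a) g"
    using assms continuous_on_cong by metis
  with assms show ?thesis using poly_limit_unique interval_calculus_limit by metis
qed

lemma norm_interval_calculus_le:
  assumes "continuous_on (calculus_interval a) f" "\<forall>x\<in>calculus_interval a. \<bar>f x\<bar> \<le> c"
  shows "norm (interval_calculus a f) \<le> c"
  using assms norm_poly_limit_le interval_calculus_limit by blast

lemma interval_calculus_sum:
  assumes "finite S" "\<And>i. i \<in> S \<Longrightarrow> continuous_on (calculus_interval a) (f i)"
  shows "interval_calculus a (\<lambda>x. \<Sum>i\<in>S. f i x) = (\<Sum>i\<in>S. interval_calculus a (f i))"
  using assms
proof (induction S rule: finite_induct)
  case empty
  then show ?case using interval_calculus_const[of a 0] by simp
next
  case (insert i S)
  then show ?case by (simp add: interval_calculus_add continuous_on_sum)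
qed

lemma poly_limit_in_generated: "poly_limit a f y \<Longrightarrow> y \<in> generated_subalgebra a"
  by (auto simp: poly_limit_def generated_subalgebra_iff)

lemma jb_poly_pcompose: "jb_poly (pcompose p q) a = jb_poly p (jb_poly q a)"
proof (induction p)
  case (pCons c p)
  have "jb_poly (pCons c p) b = c *\<^sub>R 1 + b * jb_poly p b" for b :: 'a
  proof -
    have "pCons c p = [:c:] + [:0, 1:] * p" by simp
    then show ?thesis by (simp only: jb_poly_add jb_poly_mult jb_poly_const jb_poly_linear) simp
  qed
  then show ?case using pCons by (simp add: pcompose_pCons jb_poly_add jb_poly_mult)
qed simp

text \<open>
  Needed because spectral values concern the inverse of \<open>a - r 1\<close>, whereas the calculus is built
  from polynomials in \<open>a\<close>.
\<close>

lemma generated_subalgebra_shift: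
  "generated_subalgebra a \<subseteq> generated_subalgebra (a - r *\<^sub>R 1)"
proof
  fix x assume "x \<in> generated_subalgebra a"
  then obtain p where p: "(\<lambda>n. jb_poly (p n) a) \<longlonglongrightarrow> x" by (auto simp: generated_subalgebra_iff)
  have "jb_poly q a = jb_poly (pcompose q [:r, 1:]) (a - r *\<^sub>R 1)" for q
    by (simp add: jb_poly_pcompose)
  with p have "(\<lambda>n. jb_poly (pcompose (p n) [:r, 1:]) (a - r *\<^sub>R 1)) \<longlonglongrightarrow> x" by simp
  then show "x \<in> generated_subalgebra (a - r *\<^sub>R 1)"
    unfolding generated_subalgebra_iff by (rule exI[of _ "\<lambda>n. pcompose (p n) [:r, 1:]"])
qed

lemma interval_calculus_in_generated_shift:
  assumes "continuous_on (calculus_interval a) f"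
  shows "interval_calculus a f \<in> generated_subalgebra (a - r *\<^sub>R 1)"
  using interval_calculus_limit[OF assms] poly_limit_in_generated generated_subalgebra_shift by blast

section \<open>The spectrum as the support of the calculus\<close>

definition supported_near :: "'a::unital_jb_algebra \<Rightarrow> real \<Rightarrow> real \<Rightarrow> (real \<Rightarrow> real) \<Rightarrow> bool" where
  "supported_near a r d g \<longleftrightarrow> continuous_on (calculus_interval a) g \<and>
     (\<forall>x\<in>calculus_interval a. d \<le> \<bar>x - r\<bar> \<longrightarrow> g x = 0)"

definition locally_null :: "'a::unital_jb_algebra \<Rightarrow> real \<Rightarrow> real \<Rightarrow> bool" where
  "locally_null a r d \<longleftrightarrow> (\<forall>g. supported_near a r d g \<longrightarrow> interval_calculus a g = 0)"

text \<open>
  Each application of the hypothesis \<open>step\<close> costs a factor \<open>K\<close> in the norm and gains a factor \<open>s\<close> in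
  the supremum. Iterating it bounds \<open>norm (interval_calculus a g)\<close> by \<open>(K s)\<^sup>n sup \<bar>g\<bar>\<close> for every \<open>n\<close>.
\<close>

lemma locally_nullI:
  fixes a :: "'a::unital_jb_algebra"
  assumes "0 \<le> K" "0 \<le> s" "K * s < 1"
    and step: "\<And>g. supported_near a r d g \<Longrightarrow> \<exists>h. supported_near a r d h \<and>
       norm (interval_calculus a g) \<le> K * norm (interval_calculus a h) \<and>
       (\<forall>x\<in>calculus_interval a. \<bar>h x\<bar> \<le> s * \<bar>g x\<bar>)"
  shows "locally_null a r d"
  unfolding locally_null_def
proof (intro allI impI)
  have iter: "supported_near a r d g \<Longrightarrow> (\<forall>x\<in>calculus_interval a. \<bar>g x\<bar> \<le> M) \<Longrightarrow>
      norm (interval_calculus a g) \<le> (K * s) ^ n * M" for n g M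
  proof (induction n arbitrary: g M)
    case 0
    then show ?case by (auto simp: supported_near_def intro: norm_interval_calculus_le)
  next
    case (Suc n)
    from step[OF Suc.prems(1)] obtain h where h: "supported_near a r d h"
       "norm (interval_calculus a g) \<le> K * norm (interval_calculus a h)"
       "\<forall>x\<in>calculus_interval a. \<bar>h x\<bar> \<le> s * \<bar>g x\<bar>" by blast
    have "\<forall>x\<in>calculus_interval a. \<bar>h x\<bar> \<le> s * M"
      using h(3) Suc.prems(2) \<open>0 \<le> s\<close> by (meson mult_left_mono order_trans)
    from Suc.IH[OF h(1) this] have "norm (interval_calculus a h) \<le> (K * s) ^ n * (s * M)" .
    with h(2) have "norm (interval_calculus a g) \<le> K * ((K * s) ^ n * (s * M))"
      using \<open>0 \<le> K\<close> by (meson mult_left_mono order_trans)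
    then show ?case by (simp add: algebra_simps)
  qed
  fix g assume g: "supported_near a r d g"
  then have "bounded (g ` calculus_interval a)"
    using compact_calculus_interval
    by (auto simp: supported_near_def intro!: compact_imp_bounded compact_continuous_image)
  then obtain M where M: "\<forall>x\<in>calculus_interval a. \<bar>g x\<bar> \<le> M" by (auto simp: bounded_iff)
  have "(\<lambda>n. (K * s) ^ n * M) \<longlonglongrightarrow> 0 * M"
    using assms by (intro tendsto_mult LIMSEQ_power_zero tendsto_const) auto
  then have "norm (interval_calculus a g) \<le> 0 * M"
    by (rule tendsto_lowerbound) (auto simp: iter[OF g M])
  then show "interval_calculus a g = 0" by simp
qed

text \<open>
  Let \<open>b\<close> be a Jordan inverse of \<open>a - r 1\<close>. It recovers \<open>g(a)\<close> from \<open>h(a)\<close>, where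
  \<open>h x = (x - r) g x\<close>, at the cost of a factor \<open>norm b\<close>. If \<open>g\<close> is supported within \<open>d\<close> of \<open>r\<close> then
  \<open>\<bar>h\<bar> \<le> d \<bar>g\<bar>\<close>, and \<open>d\<close> is chosen so that \<open>norm b * d < 1\<close>.
\<close>

lemma locally_null_off_spectrum:
  fixes a :: "'a::unital_jb_algebra"
  assumes "r \<notin> jb_spectrum a"
  shows "\<exists>d>0. locally_null a r d"
proof -
  from assms obtain b where b: "jb_is_inverse (a - r *\<^sub>R 1) b"
    by (auto simp: jb_spectrum_def jb_invertible_def)
  define d where "d = 1 / (2 * norm b + 2)"
  have n: "2 * norm b + 2 > 0" using norm_ge_zero[of b] by linarith
  have d: "d > 0" unfolding d_def using n by (intro divide_pos_pos) auto
  have bd: "norm b * d < 1"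
    unfolding d_def using n norm_ge_zero[of b]
    by (simp only: times_divide_eq_right mult_1_right divide_less_eq_1_pos)
  have "locally_null a r d"
  proof (rule locally_nullI[of "norm b" d])
    fix g assume g: "supported_near a r d g"
    then have cont: "continuous_on (calculus_interval a) g" by (simp add: supported_near_def)
    let ?h = "\<lambda>x. (x - r) * g x"
    have "supported_near a r d ?h"
      using g by (auto simp: supported_near_def intro!: continuous_intros)
    moreover have "b * ((a - r *\<^sub>R 1) * interval_calculus a g) = interval_calculus a g"
      by (rule jb_inverse_cancels[OF b interval_calculus_in_generated_shift[OF cont]])
    then have "interval_calculus a g = b * interval_calculus a ?h"
      using cont by (subst interval_calculus_mult) (auto intro!: continuous_intros simp: interval_calculus_shift)
    then have "norm (interval_calculus a g) \<le> norm b * norm (interval_calculus a ?h)"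
      using jb_norm_mult by metis
    moreover have "\<bar>?h x\<bar> \<le> d * \<bar>g x\<bar>" if "x \<in> calculus_interval a" for x
    proof (cases "d \<le> \<bar>x - r\<bar>")
      case True
      then show ?thesis using g that by (simp add: supported_near_def)
    next
      case False
      then show ?thesis by (auto simp: abs_mult intro!: mult_right_mono)
    qed
    ultimately show "\<exists>h. supported_near a r d h \<and>
       norm (interval_calculus a g) \<le> norm b * norm (interval_calculus a h) \<and>
       (\<forall>x\<in>calculus_interval a. \<bar>h x\<bar> \<le> d * \<bar>g x\<bar>)" by blast
  qed (use d bd in auto)
  with d show ?thesis by blast
qed

text \<open>
  Take a continuous \<open>k\<close> that equals \<open>1 / (x - r)\<close> at distance at least \<open>d\<close> from \<open>r\<close>. Then
  \<open>1 - (x - r) k x\<close> is supported near \<open>r\<close>, so the calculus cannot see it, and the image of \<open>k\<close> inverts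
  \<open>a - r 1\<close>.
\<close>

lemma locally_null_imp_off_spectrum:
  fixes a :: "'a::unital_jb_algebra"
  assumes "d > 0" "locally_null a r d"
  shows "r \<notin> jb_spectrum a"
proof -
  let ?k = "\<lambda>x. (x - r) / max ((x - r)\<^sup>2) (d\<^sup>2)"
  have pos: "max ((x - r)\<^sup>2) (d\<^sup>2) > 0" for x using assms(1) by (simp add: less_max_iff_disj)
  then have nz: "max ((x - r)\<^sup>2) (d\<^sup>2) \<noteq> 0" for x by (metis less_irrefl)
  have cont: "continuous_on (calculus_interval a) ?k" "continuous_on (calculus_interval a) (\<lambda>x. x - r)"
    using nz by (auto intro!: continuous_intros)
  have "supported_near a r d (\<lambda>x. 1 - (x - r) * ?k x)"
    unfolding supported_near_def
  proof (intro conjI ballI impI)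
    show "continuous_on (calculus_interval a) (\<lambda>x. 1 - (x - r) * ?k x)"
      using cont by (intro continuous_intros nz ballI)
    fix x assume "d \<le> \<bar>x - r\<bar>"
    then have "d\<^sup>2 \<le> (x - r)\<^sup>2" using assms(1) by (simp add: abs_le_square_iff[symmetric])
    then have "max ((x - r)\<^sup>2) (d\<^sup>2) = (x - r) * (x - r)" by (simp add: power2_eq_square)
    then show "1 - (x - r) * ?k x = 0" using \<open>d \<le> \<bar>x - r\<bar>\<close> assms(1) by auto
  qed
  then have "interval_calculus a (\<lambda>x. 1 - (x - r) * ?k x) = 0"
    using assms(2) by (simp add: locally_null_def)
  moreover have "interval_calculus a (\<lambda>x. 1 - (x - r) * ?k x)
      = interval_calculus a (\<lambda>x. 1) - interval_calculus a (\<lambda>x. (x - r) * ?k x)"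
    by (rule interval_calculus_diff) (intro continuous_on_const continuous_on_mult cont)+
  moreover have "interval_calculus a (\<lambda>x. (x - r) * ?k x) = (a - r *\<^sub>R 1) * interval_calculus a ?k"
    by (simp only: interval_calculus_mult[OF cont(2,1)] interval_calculus_shift)
  ultimately have "(a - r *\<^sub>R 1) * interval_calculus a ?k = 1"
    using interval_calculus_const[of a 1] by simp
  from jb_inverse_eqI(1)[OF interval_calculus_in_generated_shift[OF cont(1)] this]
  show ?thesis by (auto simp: jb_spectrum_def jb_invertible_def)
qed

lemma spectrum_subset_interval: "jb_spectrum a \<subseteq> calculus_interval a"
proof
  fix r assume r: "r \<in> jb_spectrum a"
  show "r \<in> calculus_interval a"
  proof (rule ccontr)
    assume out: "r \<notin> calculus_interval a"
    define d where "d = \<bar>r\<bar> - (norm a + 1)"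
    have "d > 0" using out by (simp add: d_def calculus_interval_iff)
    moreover have "locally_null a r d"
      unfolding locally_null_def
    proof (intro allI impI)
      fix g assume g: "supported_near a r d g"
      have "\<forall>x\<in>calculus_interval a. \<bar>g x\<bar> \<le> 0"
      proof
        fix x assume x: "x \<in> calculus_interval a"
        then have "d \<le> \<bar>x - r\<bar>" by (auto simp: d_def calculus_interval_iff)
        with g x show "\<bar>g x\<bar> \<le> 0" by (simp add: supported_near_def)
      qed
      then have "norm (interval_calculus a g) \<le> 0"
        using g by (intro norm_interval_calculus_le) (auto simp: supported_near_def)
      then show "interval_calculus a g = 0" by simp
    qed
    ultimately show False using locally_null_imp_off_spectrum r by blast
  qed
qed

lemma closed_spectrum: "closed (jb_spectrum a)"
proof -
  have "open (- jb_spectrum a)"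
  proof (rule openI)
    fix r assume "r \<in> - jb_spectrum a"
    then obtain d where d: "d > 0" "locally_null a r d" using locally_null_off_spectrum by blast
    have "r' \<in> - jb_spectrum a" if "r' \<in> ball r (d / 2)" for r'
    proof -
      have "locally_null a r' (d / 2)" unfolding locally_null_def
      proof (intro allI impI)
        fix g assume g: "supported_near a r' (d / 2) g"
        have "g x = 0" if "x \<in> calculus_interval a" "d \<le> \<bar>x - r\<bar>" for x
        proof -
          have "d / 2 \<le> \<bar>x - r'\<bar>" using that \<open>r' \<in> ball r (d / 2)\<close> unfolding mem_ball dist_real_def by linarith
          then show ?thesis using g that by (simp add: supported_near_def)
        qed
        then have "supported_near a r d g" using g by (simp add: supported_near_def)
        then show "interval_calculus a g = 0" using d(2) by (simp add: locally_null_def)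
      qed
      then show ?thesis using locally_null_imp_off_spectrum[of "d / 2"] d(1) by simp
    qed
    then show "\<exists>e>0. ball r e \<subseteq> - jb_spectrum a" using d(1) by (intro exI[of _ "d / 2"]) auto
  qed
  then show ?thesis by (simp add: closed_def)
qed

text \<open>
  Up to an error \<open>e\<close> in the supremum norm, \<open>f\<close> may be replaced by the function \<open>h\<close> obtained by moving
  its values towards \<open>0\<close> by \<open>e\<close>, so that \<open>h\<close> lives on the compact set \<open>K\<close> where \<open>\<bar>f\<bar> \<ge> e\<close>. As \<open>K\<close> misses
  the spectrum, finitely many locally null neighbourhoods cover it, and a partition of unity
  subordinate to them writes \<open>h\<close> as a sum of functions that the calculus annihilates.
\<close>

lemma interval_calculus_eq_0:
  fixes a :: "'a::unital_jb_algebra"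
  assumes f: "continuous_on (calculus_interval a) f" and zero: "\<forall>x\<in>jb_spectrum a. f x = 0"
  shows "interval_calculus a f = 0"
proof -
  let ?I = "calculus_interval a"
  have "norm (interval_calculus a f) \<le> 0 + e" if e: "e > 0" for e
  proof -
    define w where "w = (\<lambda>x. max (- e) (min e (f x)))"
    define h where "h = (\<lambda>x. f x - w x)"
    define K where "K = {x \<in> ?I. e \<le> \<bar>f x\<bar>}"
    have cw: "continuous_on ?I w" "continuous_on ?I h"
      unfolding w_def h_def using f by (auto intro!: continuous_intros)
    have "closedin (top_of_set ?I) (?I \<inter> (\<lambda>x. \<bar>f x\<bar>) -` {e..})"
      by (rule continuous_closedin_preimage) (use f in \<open>auto intro!: continuous_intros\<close>)
    moreover have "?I \<inter> (\<lambda>x. \<bar>f x\<bar>) -` {e..} = K" by (auto simp: K_def)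
    ultimately have "compact K"
      using compact_calculus_interval closedin_compact by metis
    have "\<forall>r\<in>K. \<exists>d>0. locally_null a r d"
    proof
      fix r assume "r \<in> K"
      then have "r \<notin> jb_spectrum a" using zero e by (auto simp: K_def)
      then show "\<exists>d>0. locally_null a r d" by (rule locally_null_off_spectrum)
    qed
    then obtain d where d: "\<And>r. r \<in> K \<Longrightarrow> d r > 0" "\<And>r. r \<in> K \<Longrightarrow> locally_null a r (d r)" by metis
    have "K \<subseteq> (\<Union>r\<in>K. ball r (d r))" using d(1) by force
    then obtain F where F: "F \<subseteq> K" "finite F" "K \<subseteq> (\<Union>r\<in>F. ball r (d r))"
      by (rule compactE_image[OF \<open>compact K\<close> open_ball])
    define bump where "bump = (\<lambda>r x. max 0 (d r - \<bar>x - r\<bar>))"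
    \<comment> \<open>the second summand keeps the denominator positive off \<open>K\<close> and vanishes on \<open>K\<close>\<close>
    define c where "c = (\<lambda>x. (\<Sum>r\<in>F. bump r x) + max 0 (e - \<bar>f x\<bar>))"
    have bump_nonneg: "0 \<le> (\<Sum>r\<in>F. bump r x)" for x by (auto simp: bump_def intro: sum_nonneg)
    have cpos: "c x > 0" if "x \<in> ?I" for x
    proof (cases "e \<le> \<bar>f x\<bar>")
      case True
      then have "x \<in> K" using that by (simp add: K_def)
      then obtain r where r: "r \<in> F" "x \<in> ball r (d r)" using F by auto
      then have "0 < bump r x" by (auto simp: bump_def dist_real_def)
      also have "\<dots> \<le> (\<Sum>r\<in>F. bump r x)"
        by (rule member_le_sum) (use r F in \<open>auto simp: bump_def\<close>)
      finally show ?thesis by (auto simp: c_def)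
    next
      case False
      then show ?thesis using bump_nonneg[of x] by (auto simp: c_def)
    qed
    have cc: "continuous_on ?I c"
      unfolding c_def bump_def using f by (auto intro!: continuous_intros)
    have chc: "continuous_on ?I (\<lambda>x. h x / c x)"
      using cw cc cpos by (intro continuous_on_divide) force+
    have cb: "continuous_on ?I (\<lambda>x. bump r x * (h x / c x))" for r
      by (intro continuous_on_mult chc) (auto simp: bump_def intro!: continuous_intros)
    have split: "(\<Sum>r\<in>F. bump r x * (h x / c x)) = h x" if "x \<in> ?I" for x
    proof (cases "e \<le> \<bar>f x\<bar>")
      case True
      then have "c x = (\<Sum>r\<in>F. bump r x)" by (simp add: c_def)
      then have "(\<Sum>r\<in>F. bump r x * (h x / c x)) = c x * (h x / c x)"
        by (simp only: sum_distrib_right)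
      then show ?thesis using cpos[OF that] by simp
    next
      case False
      then have "h x = 0" by (auto simp: h_def w_def)
      then show ?thesis by simp
    qed
    have "interval_calculus a h = interval_calculus a (\<lambda>x. \<Sum>r\<in>F. bump r x * (h x / c x))"
      by (rule interval_calculus_cong[OF cw(2)]) (use split in force)
    also have "\<dots> = (\<Sum>r\<in>F. interval_calculus a (\<lambda>x. bump r x * (h x / c x)))"
      by (rule interval_calculus_sum[OF F(2) cb])
    also have "\<dots> = 0"
    proof (rule sum.neutral, rule ballI)
      fix r assume "r \<in> F"
      then have "locally_null a r (d r)" using F(1) d(2) by blast
      moreover have "supported_near a r (d r) (\<lambda>x. bump r x * (h x / c x))"
        unfolding supported_near_def using cb by (auto simp: bump_def)
      ultimately show "interval_calculus a (\<lambda>x. bump r x * (h x / c x)) = 0"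
        by (simp add: locally_null_def)
    qed
    finally have h0: "interval_calculus a h = 0" .
    have "interval_calculus a f = interval_calculus a (\<lambda>x. h x + w x)" by (simp add: h_def)
    also have "\<dots> = interval_calculus a w" by (simp add: interval_calculus_add cw h0)
    also have "norm \<dots> \<le> e"
      by (rule norm_interval_calculus_le[OF cw(1)]) (use e in \<open>auto simp: w_def\<close>)
    finally show ?thesis by simp
  qed
  then have "norm (interval_calculus a f) \<le> 0" by (rule field_le_epsilon)
  then show ?thesis by simp
qed

lemma interval_calculus_cong_spectrum:
  assumes "continuous_on (calculus_interval a) f" "continuous_on (calculus_interval a) g"
    "\<forall>x\<in>jb_spectrum a. f x = g x"
  shows "interval_calculus a f = interval_calculus a g"
  using interval_calculus_eq_0[of a "\<lambda>x. f x - g x"] interval_calculus_diff[OF assms(1,2)] assms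
  by (simp add: continuous_on_diff)

text \<open>
  If \<open>\<bar>f\<bar> \<le> c\<close> on the spectrum, clamping \<open>f\<close> to \<open>[-c, c]\<close> does not change its image. Conversely, suppose
  \<open>\<bar>f r\<bar> > c' > c \<ge> norm (f(a))\<close>. Near \<open>r\<close> one can divide by \<open>f\<close>, and passing from \<open>g\<close> to \<open>g / f\<close> costs
  at most \<open>c\<close> in the norm and gains \<open>1 / c'\<close> in the supremum. Hence the calculus vanishes near \<open>r\<close>,
  and \<open>r\<close> is not a spectral value.
\<close>

lemma norm_interval_calculus_le_iff:
  fixes a :: "'a::unital_jb_algebra"
  assumes f: "continuous_on (calculus_interval a) f" and "c \<ge> 0"
  shows "norm (interval_calculus a f) \<le> c \<longleftrightarrow> (\<forall>x\<in>jb_spectrum a. \<bar>f x\<bar> \<le> c)"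
proof
  assume bound: "\<forall>x\<in>jb_spectrum a. \<bar>f x\<bar> \<le> c"
  let ?w = "\<lambda>x. max (- c) (min c (f x))"
  have cw: "continuous_on (calculus_interval a) ?w" using f by (auto intro!: continuous_intros)
  have "interval_calculus a f = interval_calculus a ?w"
    by (rule interval_calculus_cong_spectrum[OF f cw]) (use bound in \<open>fastforce simp: abs_le_iff\<close>)
  also have "norm \<dots> \<le> c"
    by (rule norm_interval_calculus_le[OF cw]) (use \<open>c \<ge> 0\<close> in auto)
  finally show "norm (interval_calculus a f) \<le> c" .
next
  let ?I = "calculus_interval a"
  assume le: "norm (interval_calculus a f) \<le> c"
  show "\<forall>x\<in>jb_spectrum a. \<bar>f x\<bar> \<le> c"
  proof (intro ballI, rule ccontr)
    fix r assume r: "r \<in> jb_spectrum a" "\<not> \<bar>f r\<bar> \<le> c"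
    then obtain c' where c': "c < c'" "c' < \<bar>f r\<bar>" using dense by (metis not_le)
    have "r \<in> ?I" using r spectrum_subset_interval by blast
    then have "\<exists>d>0. \<forall>x\<in>?I. dist x r < d \<longrightarrow> dist (f x) (f r) < \<bar>f r\<bar> - c'"
      using f c' by (simp add: continuous_on_iff)
    then obtain d where d: "d > 0" "\<And>x. x \<in> ?I \<Longrightarrow> dist x r < d \<Longrightarrow> dist (f x) (f r) < \<bar>f r\<bar> - c'"
      by blast
    have big: "c' < \<bar>f x\<bar>" if "x \<in> ?I" "\<bar>x - r\<bar> < d" for x
      using d(2)[of x] that by (auto simp: dist_real_def)
    have "locally_null a r d"
    proof (rule locally_nullI[of c "1 / c'"])
      fix g assume g: "supported_near a r d g"
      \<comment> \<open>\<open>f / ?m\<close> is a continuous function that agrees with \<open>1 / f\<close> where \<open>\<bar>f\<bar> \<ge> c'\<close>\<close>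
      let ?m = "\<lambda>x. max ((f x)\<^sup>2) (c'\<^sup>2)"
      let ?h = "\<lambda>x. g x * f x / ?m x"
      have "c' > 0" using c' \<open>c \<ge> 0\<close> by linarith
      then have pos: "?m x > 0" for x by (simp add: less_max_iff_disj)
      then have nz: "?m x \<noteq> 0" for x by (metis less_irrefl)
      have ch: "continuous_on ?I ?h"
        using g f nz by (auto simp: supported_near_def intro!: continuous_intros)
      have outside: "g x = 0" if "x \<in> ?I" "\<not> \<bar>x - r\<bar> < d" for x
        using g that by (auto simp: supported_near_def)
      have inside: "?h x = g x / f x" "f x \<noteq> 0" if "x \<in> ?I" "\<bar>x - r\<bar> < d" for x
      proof -
        have "c'\<^sup>2 \<le> (f x)\<^sup>2" using big[OF that] \<open>c' > 0\<close> by (simp add: abs_le_square_iff[symmetric])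
        then show "?h x = g x / f x" by (simp add: power2_eq_square)
        show "f x \<noteq> 0" using big[OF that] \<open>c' > 0\<close> by auto
      qed
      have "supported_near a r d ?h" using ch g by (simp add: supported_near_def)
      moreover have "interval_calculus a g = interval_calculus a (\<lambda>x. f x * ?h x)"
      proof (rule interval_calculus_cong)
        show "continuous_on ?I g" using g by (simp add: supported_near_def)
        show "\<forall>x\<in>?I. g x = f x * ?h x"
          using inside outside by (metis (no_types, lifting) mult_zero_left div_0 mult_zero_right nonzero_mult_div_cancel_left times_divide_eq_right)
      qed
      then have "interval_calculus a g = interval_calculus a f * interval_calculus a ?h"
        using interval_calculus_mult[OF f ch] by simp
      then have "norm (interval_calculus a g) \<le> norm (interval_calculus a f) * norm (interval_calculus a ?h)"
        using jb_norm_mult by metis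
      then have "norm (interval_calculus a g) \<le> c * norm (interval_calculus a ?h)"
        using le by (meson mult_right_mono norm_ge_zero order_trans)
      moreover have "\<bar>?h x\<bar> \<le> 1 / c' * \<bar>g x\<bar>" if "x \<in> ?I" for x
      proof (cases "\<bar>x - r\<bar> < d")
        case True
        have "\<bar>?h x\<bar> = \<bar>g x\<bar> / \<bar>f x\<bar>" using inside(1)[OF that True] by (simp only: abs_divide)
        also have "\<dots> \<le> \<bar>g x\<bar> / c'"
          using big[OF that True] \<open>c' > 0\<close> by (intro divide_left_mono) auto
        finally show ?thesis by simp
      next
        case False
        then show ?thesis using outside[OF that] by simp
      qed
      ultimately show "\<exists>h. supported_near a r d h \<and>
       norm (interval_calculus a g) \<le> c * norm (interval_calculus a h) \<and>
       (\<forall>x\<in>?I. \<bar>h x\<bar> \<le> 1 / c' * \<bar>g x\<bar>)" by blast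
    qed (use c' \<open>c \<ge> 0\<close> in auto)
    then show False using locally_null_imp_off_spectrum[OF d(1)] r(1) by blast
  qed
qed

text \<open>
  Extend functions from the closed spectrum to the interval by Tietze's theorem; the choice of
  extension does not affect the image, and the norm only sees values on the spectrum.
\<close>

lemma ex_functional_calculus:
  fixes a :: "'a::unital_jb_algebra"
  shows "\<exists>\<Phi>. jb_functional_calculus a \<Phi>"
proof -
  let ?I = "calculus_interval a" and ?S = "jb_spectrum a"
  have ex: "\<exists>g. continuous_on ?I g \<and> (\<forall>x\<in>?S. g x = f x)" if "continuous_on ?S f" for f :: "real \<Rightarrow> real"
  proof -
    have "closedin (top_of_set ?I) ?S"
      using closed_spectrum spectrum_subset_interval closed_subset by blast
    from Tietze_unbounded[OF that this] show ?thesis by metis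
  qed
  define ext where "ext f = (SOME g. continuous_on ?I g \<and> (\<forall>x\<in>?S. g x = f x))" for f :: "real \<Rightarrow> real"
  have ext: "continuous_on ?I (ext f)" "\<And>x. x \<in> ?S \<Longrightarrow> ext f x = f x"
    if "continuous_on ?S f" for f :: "real \<Rightarrow> real"
    using someI_ex[OF ex[OF that]] by (auto simp: ext_def)
  define \<Phi> where "\<Phi> f = interval_calculus a (ext f)" for f
  have \<Phi>_eq: "\<Phi> f = interval_calculus a g"
    if "continuous_on ?S f" "continuous_on ?I g" "\<And>x. x \<in> ?S \<Longrightarrow> g x = f x" for f g :: "real \<Rightarrow> real"
    unfolding \<Phi>_def using that ext by (intro interval_calculus_cong_spectrum) auto
  have "jb_functional_calculus a \<Phi>"
    unfolding jb_functional_calculus_def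
  proof (intro conjI allI impI)
    fix f g :: "real \<Rightarrow> real" assume fg: "continuous_on ?S f" "continuous_on ?S g"
    have "\<Phi> (\<lambda>x. f x + g x) = interval_calculus a (\<lambda>x. ext f x + ext g x)"
      by (rule \<Phi>_eq) (use fg ext in \<open>auto intro!: continuous_intros\<close>)
    then show "\<Phi> (\<lambda>x. f x + g x) = \<Phi> f + \<Phi> g"
      by (simp add: \<Phi>_def interval_calculus_add ext fg)
    have "\<Phi> (\<lambda>x. f x * g x) = interval_calculus a (\<lambda>x. ext f x * ext g x)"
      by (rule \<Phi>_eq) (use fg ext in \<open>auto intro!: continuous_intros\<close>)
    then show "\<Phi> (\<lambda>x. f x * g x) = \<Phi> f * \<Phi> g"
      by (simp add: \<Phi>_def interval_calculus_mult ext fg)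
  next
    fix f :: "real \<Rightarrow> real" and c :: real assume f: "continuous_on ?S f"
    have "\<Phi> (\<lambda>x. c * f x) = interval_calculus a (\<lambda>x. c * ext f x)"
      by (rule \<Phi>_eq) (use f ext in \<open>auto intro!: continuous_intros\<close>)
    then show "\<Phi> (\<lambda>x. c * f x) = c *\<^sub>R \<Phi> f"
      by (simp add: \<Phi>_def interval_calculus_scale ext f)
  next
    have "\<Phi> (\<lambda>x. 1) = interval_calculus a (\<lambda>x. 1)" by (rule \<Phi>_eq) auto
    then show "\<Phi> (\<lambda>x. 1) = 1" by (simp add: interval_calculus_const)
    have "\<Phi> (\<lambda>x. x) = interval_calculus a (\<lambda>x. x - 0)" by (rule \<Phi>_eq) auto
    then show "\<Phi> (\<lambda>x. x) = a" by (simp only: interval_calculus_shift) simp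
  next
    fix f :: "real \<Rightarrow> real" and c :: real assume f: "continuous_on ?S f" "0 \<le> c"
    show "(norm (\<Phi> f) \<le> c) = (\<forall>x\<in>?S. \<bar>f x\<bar> \<le> c)"
      unfolding \<Phi>_def using ext f by (simp add: norm_interval_calculus_le_iff)
  qed
  then show ?thesis by blast
qed

section \<open>Consequences of the functional calculus\<close>

lemma jb_apply_functional_calculus: "jb_functional_calculus a (\<lambda>f. jb_apply f a)"
  using someI_ex[OF ex_functional_calculus[of a]] by (simp add: jb_apply_def)

lemma jb_apply_add:
  assumes "continuous_on (jb_spectrum a) f" "continuous_on (jb_spectrum a) g"
  shows "jb_apply (\<lambda>x. f x + g x) a = jb_apply f a + jb_apply g a"
  using jb_apply_functional_calculus[of a] assms unfolding jb_functional_calculus_def by blast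

lemma jb_apply_mult:
  assumes "continuous_on (jb_spectrum a) f" "continuous_on (jb_spectrum a) g"
  shows "jb_apply (\<lambda>x. f x * g x) a = jb_apply f a * jb_apply g a"
  using jb_apply_functional_calculus[of a] assms unfolding jb_functional_calculus_def by blast

lemma jb_apply_scale:
  assumes "continuous_on (jb_spectrum a) f"
  shows "jb_apply (\<lambda>x. c * f x) a = c *\<^sub>R jb_apply f a"
  using jb_apply_functional_calculus[of a] assms unfolding jb_functional_calculus_def by blast

lemma jb_apply_1: "jb_apply (\<lambda>x. 1) a = 1"
  using jb_apply_functional_calculus[of a] unfolding jb_functional_calculus_def by blast

lemma jb_apply_id: "jb_apply (\<lambda>x. x) a = a"
  using jb_apply_functional_calculus[of a] unfolding jb_functional_calculus_def by blast

lemma norm_jb_apply_le_iff: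
  assumes "continuous_on (jb_spectrum a) f" "0 \<le> c"
  shows "norm (jb_apply f a) \<le> c \<longleftrightarrow> (\<forall>x\<in>jb_spectrum a. \<bar>f x\<bar> \<le> c)"
  using jb_apply_functional_calculus[of a] assms unfolding jb_functional_calculus_def by blast

lemma jb_apply_const: "jb_apply (\<lambda>x. c) a = c *\<^sub>R 1"
  using jb_apply_scale[of a "\<lambda>x. 1" c] by (simp add: jb_apply_1)

lemma jb_apply_diff:
  assumes "continuous_on (jb_spectrum a) f" "continuous_on (jb_spectrum a) g"
  shows "jb_apply (\<lambda>x. f x - g x) a = jb_apply f a - jb_apply g a"
proof -
  have "jb_apply (\<lambda>x. f x + (-1) * g x) a = jb_apply f a + jb_apply (\<lambda>x. (-1) * g x) a"
    by (rule jb_apply_add) (use assms in \<open>auto intro!: continuous_intros\<close>)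
  then show ?thesis using jb_apply_scale[OF assms(2), of "-1"] by simp
qed

lemma norm_jb_apply_diff_le:
  assumes "continuous_on (jb_spectrum a) f" "continuous_on (jb_spectrum a) g" "0 \<le> c"
    and "\<And>x. x \<in> jb_spectrum a \<Longrightarrow> \<bar>f x - g x\<bar> \<le> c"
  shows "norm (jb_apply f a - jb_apply g a) \<le> c"
  using norm_jb_apply_le_iff[of a "\<lambda>x. f x - g x" c] assms
  by (simp add: jb_apply_diff continuous_on_diff)

lemma jb_apply_cong:
  assumes "continuous_on (jb_spectrum a) f" "\<And>x. x \<in> jb_spectrum a \<Longrightarrow> f x = g x"
  shows "jb_apply f a = jb_apply g a"
proof -
  have "continuous_on (jb_spectrum a) g" using assms continuous_on_cong by metis
  from norm_jb_apply_diff_le[OF assms(1) this, of 0] assms(2) show ?thesis by simp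
qed

lemma jb_apply_power:
  assumes "continuous_on (jb_spectrum a) g"
  shows "jb_apply (\<lambda>x. g x ^ n) a = jb_power (jb_apply g a) n"
proof (induction n)
  case (Suc n)
  have "jb_apply (\<lambda>x. g x * g x ^ n) a = jb_apply g a * jb_apply (\<lambda>x. g x ^ n) a"
    by (rule jb_apply_mult) (use assms in \<open>auto intro!: continuous_intros\<close>)
  then show ?case using Suc by simp
qed (simp add: jb_apply_1)

lemma jb_apply_power_sum:
  assumes "continuous_on (jb_spectrum a) g" "finite S"
  shows "jb_apply (\<lambda>x. \<Sum>i\<in>S. c i * g x ^ i) a = (\<Sum>i\<in>S. c i *\<^sub>R jb_power (jb_apply g a) i)"
  using assms(2)
proof (induction S rule: finite_induct)
  case empty
  then show ?case using jb_apply_const[of 0 a] by simp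
next
  case (insert i S)
  have "jb_apply (\<lambda>x. c i * g x ^ i + (\<Sum>i\<in>S. c i * g x ^ i)) a
      = c i *\<^sub>R jb_apply (\<lambda>x. g x ^ i) a + jb_apply (\<lambda>x. \<Sum>i\<in>S. c i * g x ^ i) a"
  proof (subst jb_apply_add)
    show "jb_apply (\<lambda>x. c i * g x ^ i) a + jb_apply (\<lambda>x. \<Sum>i\<in>S. c i * g x ^ i) a
      = c i *\<^sub>R jb_apply (\<lambda>x. g x ^ i) a + jb_apply (\<lambda>x. \<Sum>i\<in>S. c i * g x ^ i) a"
      by (subst jb_apply_scale) (use assms(1) in \<open>auto intro!: continuous_intros\<close>)
  qed (use assms(1) in \<open>auto intro!: continuous_intros\<close>)
  then show ?case using insert by (simp add: jb_apply_power assms(1))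
qed

text \<open>
  The isometry of the calculus, applied to \<open>x - r\<close>: an element close to \<open>r 1\<close> has its spectrum close
  to \<open>r\<close>.
\<close>

lemma abs_spectrum_le:
  assumes "x \<in> jb_spectrum a"
  shows "\<bar>x - r\<bar> \<le> norm (a - r *\<^sub>R 1)"
proof -
  have "jb_apply (\<lambda>x. x - r) a = a - r *\<^sub>R 1"
    by (subst jb_apply_diff) (auto intro!: continuous_intros simp: jb_apply_id jb_apply_const)
  moreover have "continuous_on (jb_spectrum a) (\<lambda>x. x - r)" by (intro continuous_intros)
  ultimately show ?thesis
    using norm_jb_apply_le_iff[of a "\<lambda>x. x - r" "norm (a - r *\<^sub>R 1)"] assms by simp
qed

lemma compact_spectrum: "compact (jb_spectrum a)"
  using compact_calculus_interval spectrum_subset_interval closed_spectrum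
  by (metis closed_subset closedin_compact)

lemma jb_apply_in_generated:
  assumes "continuous_on (jb_spectrum a) f"
  shows "jb_apply f a \<in> generated_subalgebra a"
  unfolding generated_subalgebra_def closure_approachable
proof (intro allI impI)
  fix e :: real assume "e > 0"
  then have "e / 2 > 0" by simp
  obtain g where g: "real_polynomial_function g" "\<And>x. x \<in> jb_spectrum a \<Longrightarrow> \<bar>f x - g x\<bar> < e / 2"
    using Stone_Weierstrass_real_polynomial_function[OF compact_spectrum assms \<open>e / 2 > 0\<close>] by blast
  then obtain c n where gc: "g = (\<lambda>x. \<Sum>i\<le>n. c i * x ^ i)"
    using real_polynomial_function_iff_sum by blast
  have "jb_apply g a = jb_poly (\<Sum>i\<le>n. monom (c i) i) a"
    unfolding gc jb_poly_sum jb_poly_monom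
    using jb_apply_power_sum[of a "\<lambda>x. x" "{..n}" c] by (simp add: jb_apply_id)
  moreover have "norm (jb_apply f a - jb_apply g a) \<le> e / 2"
    using g(2) \<open>e > 0\<close> assms by (intro norm_jb_apply_diff_le)
      (auto simp: gc intro!: continuous_intros intro: less_imp_le)
  ultimately show "\<exists>y\<in>range (\<lambda>p. jb_poly p a). dist y (jb_apply f a) < e"
    using \<open>e > 0\<close> by (intro bexI[of _ "jb_apply g a"]) (auto simp: dist_norm norm_minus_commute)
qed

lemma jb_inverse_eq_jb_apply:
  assumes "0 \<notin> jb_spectrum a"
  shows "jb_inverse a = jb_apply inverse a"
proof (rule jb_inverse_eqI(2))
  have cont: "continuous_on (jb_spectrum a) inverse"
    using assms by (auto intro!: continuous_intros)
  then show "jb_apply inverse a \<in> generated_subalgebra a" by (rule jb_apply_in_generated)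
  have "a * jb_apply inverse a = jb_apply (\<lambda>x. x * inverse x) a"
    using jb_apply_mult[of a "\<lambda>x. x" inverse] cont by (simp add: jb_apply_id)
  also have "\<dots> = jb_apply (\<lambda>x. 1) a"
  proof (rule jb_apply_cong[symmetric])
    show "1 = x * inverse x" if "x \<in> jb_spectrum a" for x
      using assms that by (metis right_inverse)
  qed simp
  finally show "a * jb_apply inverse a = 1" by (simp add: jb_apply_1)
qed

text \<open>
  The isometry transports the scalar error bound: on the spectrum \<open>e * \<bar>x - r\<bar>\<close> is at most
  \<open>e * norm (a - r *\<^sub>R 1)\<close>.
\<close>

lemma norm_jb_apply_linearization_le:
  fixes a :: "'a::unital_jb_algebra"
  assumes cont: "continuous_on (ball r d) f" and near: "norm (a - r *\<^sub>R 1) < d"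
    and lin: "\<And>x. \<bar>x - r\<bar> < d \<Longrightarrow> \<bar>f x - f r - m * (x - r)\<bar> \<le> e * \<bar>x - r\<bar>" and "0 \<le> e"
  shows "norm (jb_apply f a - f r *\<^sub>R 1 - m *\<^sub>R (a - r *\<^sub>R 1)) \<le> e * norm (a - r *\<^sub>R 1)"
proof -
  let ?g = "\<lambda>x. f r + m * (x - r)"
  have dist: "\<bar>x - r\<bar> \<le> norm (a - r *\<^sub>R 1)" if "x \<in> jb_spectrum a" for x
    using abs_spectrum_le[OF that] .
  have "jb_spectrum a \<subseteq> ball r d"
    using dist near by (force simp: dist_real_def abs_minus_commute)
  then have cf: "continuous_on (jb_spectrum a) f" using cont continuous_on_subset by blast
  have "jb_apply ?g a = f r *\<^sub>R 1 + m *\<^sub>R (a - r *\<^sub>R 1)"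
    by (subst jb_apply_add, (intro continuous_intros)+, subst jb_apply_scale, intro continuous_intros,
        subst jb_apply_diff) (auto intro!: continuous_intros simp: jb_apply_const jb_apply_id)
  moreover have "norm (jb_apply f a - jb_apply ?g a) \<le> e * norm (a - r *\<^sub>R 1)"
  proof (rule norm_jb_apply_diff_le[OF cf])
    fix x assume x: "x \<in> jb_spectrum a"
    have "\<bar>f x - ?g x\<bar> \<le> e * \<bar>x - r\<bar>"
      using lin[of x] dist[OF x] near by (simp add: algebra_simps)
    also have "\<dots> \<le> e * norm (a - r *\<^sub>R 1)" using dist[OF x] \<open>0 \<le> e\<close> by (rule mult_left_mono)
    finally show "\<bar>f x - ?g x\<bar> \<le> e * norm (a - r *\<^sub>R 1)" .
  qed (use \<open>0 \<le> e\<close> in \<open>auto intro!: continuous_intros\<close>)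
  ultimately show ?thesis by (simp only: diff_diff_eq)
qed

lemma
  fixes f :: "real \<Rightarrow> real"
  assumes der: "(f has_real_derivative m) (at r)" and cont: "continuous_on (ball r d) f" and "d > 0"
  shows jb_apply_scalar: "jb_apply f (r *\<^sub>R 1) = f r *\<^sub>R (1::'a::unital_jb_algebra)"
    and jb_apply_has_derivative:
      "(jb_apply f has_derivative (\<lambda>h. m *\<^sub>R h)) (at (r *\<^sub>R (1::'a)))"
proof -
  have approx: "\<exists>\<delta>>0. \<forall>a::'a. norm (a - r *\<^sub>R 1) < \<delta> \<longrightarrow>
      norm (jb_apply f a - f r *\<^sub>R 1 - m *\<^sub>R (a - r *\<^sub>R 1)) \<le> e * norm (a - r *\<^sub>R 1)"
    if "e > 0" for e
  proof -
    have "(f has_derivative (\<lambda>h. m * h)) (at r)"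
      using der by (simp add: has_field_derivative_def)
    then obtain \<delta> where \<delta>: "\<delta> > 0"
      "\<And>x. \<bar>x - r\<bar> < \<delta> \<Longrightarrow> \<bar>f x - f r - m * (x - r)\<bar> \<le> e * \<bar>x - r\<bar>"
      using \<open>e > 0\<close> unfolding has_derivative_at_alt by auto
    have "continuous_on (ball r (min \<delta> d)) f" by (rule continuous_on_subset[OF cont]) auto
    then show ?thesis
      using norm_jb_apply_linearization_le[of r "min \<delta> d" f _ m e] \<delta> \<open>d > 0\<close> \<open>e > 0\<close>
      by (intro exI[of _ "min \<delta> d"]) auto
  qed
  from approx[of 1] obtain \<delta> where "\<delta> > 0" "\<forall>a::'a. norm (a - r *\<^sub>R 1) < \<delta> \<longrightarrow>
      norm (jb_apply f a - f r *\<^sub>R 1 - m *\<^sub>R (a - r *\<^sub>R 1)) \<le> 1 * norm (a - r *\<^sub>R 1)" by auto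
  from this(2)[rule_format, of "r *\<^sub>R 1"] this(1)
  show val: "jb_apply f (r *\<^sub>R 1) = f r *\<^sub>R (1::'a)" by simp
  show "(jb_apply f has_derivative (\<lambda>h. m *\<^sub>R h)) (at (r *\<^sub>R (1::'a)))"
    unfolding has_derivative_at_alt val using approx by (simp add: bounded_linear_scaleR_right)
qed

section \<open>The exponential\<close>

lemma uniform_limit_exp_series:
  "uniform_limit {y. \<bar>y\<bar> \<le> M} (\<lambda>n y. \<Sum>k<n. (1 / fact k) * y ^ k) (exp :: real \<Rightarrow> real) sequentially"
proof -
  have "uniform_limit {y. \<bar>y\<bar> \<le> M} (\<lambda>n y. \<Sum>k<n. (1 / fact k) * y ^ k)
      (\<lambda>y. \<Sum>k. (1 / fact k) * y ^ k :: real) sequentially"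
  proof (rule Weierstrass_m_test)
    show "summable (\<lambda>k. inverse (fact k) * M ^ k)" by (rule summable_exp)
    show "norm ((1 / fact k) * y ^ k) \<le> inverse (fact k) * M ^ k" if "y \<in> {y. \<bar>y\<bar> \<le> M}" for k and y :: real
      using that by (auto simp: abs_mult power_abs divide_inverse intro!: mult_left_mono power_mono)
  qed
  moreover have "(\<lambda>y. \<Sum>k. (1 / fact k) * y ^ k :: real) = exp"
    by (simp add: exp_def fun_eq_iff divide_inverse)
  ultimately show ?thesis by simp
qed

lemma jb_apply_exp_series:
  fixes a :: "'a::unital_jb_algebra"
  assumes g: "continuous_on (jb_spectrum a) g"
  shows "(\<lambda>k. (1 / fact k) *\<^sub>R jb_power (jb_apply g a) k) sums jb_apply (\<lambda>x. exp (g x)) a"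
  unfolding sums_def
proof (rule metric_LIMSEQ_I)
  fix e :: real assume "e > 0"
  have "bounded (g ` jb_spectrum a)"
    using g compact_spectrum by (auto intro!: compact_imp_bounded compact_continuous_image)
  then obtain M where M: "\<And>x. x \<in> jb_spectrum a \<Longrightarrow> \<bar>g x\<bar> \<le> M" by (auto simp: bounded_iff)
  have "e / 2 > 0" using \<open>e > 0\<close> by simp
  with uniform_limit_exp_series[of M]
  have "\<exists>N. \<forall>n\<ge>N. \<forall>y\<in>{y. \<bar>y\<bar> \<le> M}. dist (\<Sum>k<n. (1 / fact k) * y ^ k) (exp y) < e / 2"
    unfolding uniform_limit_sequentially_iff by (elim allE impE)
  then obtain N where N: "\<And>n y. n \<ge> N \<Longrightarrow> \<bar>y\<bar> \<le> M \<Longrightarrow> dist (\<Sum>k<n. (1 / fact k) * y ^ k) (exp y) < e / 2"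
    by auto
  show "\<exists>N. \<forall>n\<ge>N. dist (\<Sum>k<n. (1 / fact k) *\<^sub>R jb_power (jb_apply g a) k) (jb_apply (\<lambda>x. exp (g x)) a) < e"
  proof (intro exI allI impI)
    fix n assume "n \<ge> N"
    have "norm (jb_apply (\<lambda>x. \<Sum>k<n. (1 / fact k) * g x ^ k) a - jb_apply (\<lambda>x. exp (g x)) a) \<le> e / 2"
    proof (rule norm_jb_apply_diff_le)
      fix x assume "x \<in> jb_spectrum a"
      from N[OF \<open>n \<ge> N\<close> M[OF this]]
      show "\<bar>(\<Sum>k<n. (1 / fact k) * g x ^ k) - exp (g x)\<bar> \<le> e / 2" by (simp add: dist_real_def)
    qed (use g \<open>e > 0\<close> in \<open>auto intro!: continuous_intros\<close>)
    then show "dist (\<Sum>k<n. (1 / fact k) *\<^sub>R jb_power (jb_apply g a) k) (jb_apply (\<lambda>x. exp (g x)) a) < e"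
      using \<open>e > 0\<close> unfolding jb_apply_power_sum[OF g finite_lessThan] by (simp add: dist_norm)
  qed
qed

lemma jb_exp_sums: "(\<lambda>k. (1 / fact k) *\<^sub>R jb_power a k) sums jb_exp a"
  using jb_apply_exp_series[of a "\<lambda>x. x"] by (simp add: jb_exp_def jb_apply_id)

text \<open>
  Both sides are the sum of the exponential series of \<open>jb_apply g a\<close>: the left one by the calculus
  of \<open>a\<close>, the right one by that of \<open>jb_apply g a\<close>.
\<close>

lemma jb_apply_exp_comp:
  assumes "continuous_on (jb_spectrum a) g"
  shows "jb_apply (\<lambda>x. exp (g x)) a = jb_exp (jb_apply g a)"
  using jb_apply_exp_series[OF assms] jb_exp_sums sums_unique2 by blast

lemma norm_jb_power_le: "norm (jb_power a n) \<le> norm (a::'a::unital_jb_algebra) ^ n"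
proof (induction n)
  case (Suc n)
  have "norm (a * jb_power a n) \<le> norm a * norm (jb_power a n)" by (rule jb_norm_mult)
  also have "\<dots> \<le> norm a * norm a ^ n" using Suc by (intro mult_left_mono) auto
  finally show ?case by simp
qed (simp add: norm_jb_one_le)

lemma isCont_jb_exp: "isCont jb_exp (a::'a::unital_jb_algebra)"
proof -
  let ?B = "cball (0::'a) (norm a + 1)"
  have "uniform_limit ?B (\<lambda>n x. \<Sum>k<n. (1 / fact k) *\<^sub>R jb_power x k)
      (\<lambda>x. \<Sum>k. (1 / fact k) *\<^sub>R jb_power x k) sequentially"
  proof (rule Weierstrass_m_test)
    show "summable (\<lambda>k. inverse (fact k) * (norm a + 1) ^ k)" by (rule summable_exp)
    show "norm ((1 / fact k) *\<^sub>R jb_power x k) \<le> inverse (fact k) * (norm a + 1) ^ k"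
      if "x \<in> ?B" for k and x :: 'a
    proof -
      have "norm (jb_power x k) \<le> (norm a + 1) ^ k"
        using that by (intro order_trans[OF norm_jb_power_le] power_mono) auto
      then show ?thesis by (simp add: divide_inverse mult_left_mono)
    qed
  qed
  moreover have "(\<lambda>x::'a. \<Sum>k. (1 / fact k) *\<^sub>R jb_power x k) = jb_exp"
    by (rule ext) (rule sums_unique[OF jb_exp_sums, symmetric])
  ultimately have "uniform_limit ?B (\<lambda>n x. \<Sum>k<n. (1 / fact k) *\<^sub>R jb_power x k) jb_exp sequentially"
    by simp
  moreover have "continuous_on ?B (\<lambda>x. jb_power x k)" for k
    by (induction k) (auto intro!: continuous_intros jb_mult.continuous_on)
  then have "\<forall>\<^sub>F n in sequentially. continuous_on ?B (\<lambda>x. \<Sum>k<n. (1 / fact k) *\<^sub>R jb_power x k)"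
    by (intro always_eventually allI continuous_intros) auto
  ultimately have "continuous_on ?B jb_exp"
    by (intro uniform_limit_theorem[where F = sequentially and
        f = "\<lambda>n x. \<Sum>k<n. (1 / fact k) *\<^sub>R jb_power x k"]) auto
  moreover have "a \<in> interior ?B"
    by (rule subsetD[OF interior_maximal[OF ball_subset_cball open_ball]]) simp
  ultimately show ?thesis by (rule continuous_on_interior)
qed

section \<open>Curves through the unit and their tangents\<close>

text \<open>
  Curves through the unit at time \<open>0\<close> with velocity \<open>X\<close>. Every operation that enters the means sends
  such curves to such curves, and acts linearly on the velocities.
\<close>

definition unit_tangent :: "(real \<Rightarrow> 'a::unital_jb_algebra) \<Rightarrow> 'a \<Rightarrow> bool" where
  "unit_tangent F X \<longleftrightarrow> F 0 = 1 \<and> (F has_vector_derivative X) (at 0)"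

lemma has_vector_derivative_jb_apply:
  fixes F :: "real \<Rightarrow> 'a::unital_jb_algebra"
  assumes "(f has_real_derivative m) (at r)" "continuous_on (ball r d) f" "d > 0"
    and F: "F 0 = r *\<^sub>R 1" "(F has_vector_derivative X) (at 0)"
  shows "((\<lambda>t. jb_apply f (F t)) has_vector_derivative m *\<^sub>R X) (at 0)"
proof -
  have "((\<lambda>t. jb_apply f (F t)) has_derivative (\<lambda>s. m *\<^sub>R (s *\<^sub>R X))) (at 0)"
    using jb_apply_has_derivative[OF assms(1-3), where 'a = 'a] F
    by (intro has_derivative_compose[of F _ 0 UNIV "jb_apply f"]) (auto simp: has_vector_derivative_def)
  then show ?thesis by (simp add: has_vector_derivative_def mult.commute)
qed

lemma unit_tangent_exp: "unit_tangent (\<lambda>t. jb_exp (t *\<^sub>R A)) A"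
proof -
  have "((\<lambda>t. t *\<^sub>R A) has_vector_derivative A) (at 0)"
    by (auto simp: has_vector_derivative_def intro!: derivative_eq_intros)
  moreover have d: "(exp has_real_derivative 1) (at 0)"
    using DERIV_exp[of "0::real"] by simp
  moreover have c: "continuous_on (ball 0 1) (exp :: real \<Rightarrow> real)" by (intro continuous_intros)
  ultimately show ?thesis
    using has_vector_derivative_jb_apply[OF d c, of "\<lambda>t. t *\<^sub>R A" A]
      jb_apply_scalar[OF d c, where 'a = 'a]
    by (simp add: unit_tangent_def jb_exp_def)
qed

lemma unit_tangent_powr:
  assumes "unit_tangent F X"
  shows "unit_tangent (\<lambda>t. F t jpowr r) (r *\<^sub>R X)"
proof -
  have d: "((\<lambda>x. x powr r) has_real_derivative r) (at 1)"
    using has_real_derivative_powr[of 1 r] by simp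
  have c: "continuous_on (ball 1 1) (\<lambda>x::real. x powr r)"
    by (auto intro!: continuous_intros simp: dist_real_def)
  show ?thesis
    using has_vector_derivative_jb_apply[OF d c, of F X] jb_apply_scalar[OF d c, where 'a = 'a] assms
    by (auto simp: unit_tangent_def jb_powr_def)
qed

lemma unit_tangent_eventually_near:
  assumes "unit_tangent F X" "e > 0"
  shows "\<forall>\<^sub>F t in nhds 0. norm (F t - 1) < e"
proof -
  have "isCont F 0" using assms has_vector_derivative_continuous unfolding unit_tangent_def by blast
  then have "(F \<longlongrightarrow> 1) (nhds 0)"
    using assms by (simp add: isCont_def unit_tangent_def tendsto_at_iff_tendsto_nhds)
  from tendstoD[OF this \<open>e > 0\<close>] show ?thesis by (simp add: dist_norm)
qed

text \<open>
  Inverses need a detour: near the unit, \<open>jb_inverse\<close> coincides with \<open>jb_apply inverse\<close>, because the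
  spectrum stays away from \<open>0\<close>.
\<close>

lemma unit_tangent_inverse:
  assumes F: "unit_tangent F X"
  shows "unit_tangent (\<lambda>t. jb_inverse (F t)) (- X)"
proof -
  have d: "(inverse has_real_derivative -1) (at 1)"
    using DERIV_inverse[of "1::real"] by simp
  have c: "continuous_on (ball 1 1) (inverse :: real \<Rightarrow> real)"
    by (auto intro!: continuous_intros simp: dist_real_def)
  have eq: "jb_inverse b = jb_apply inverse b" if "norm (b - 1) < 1" for b :: 'a
  proof (rule jb_inverse_eq_jb_apply)
    show "0 \<notin> jb_spectrum b" using abs_spectrum_le[of 0 b 1] that by auto
  qed
  have "((\<lambda>t. jb_apply inverse (F t)) has_vector_derivative -1 *\<^sub>R X) (at 0)"
    using F by (intro has_vector_derivative_jb_apply[OF d c]) (auto simp: unit_tangent_def)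
  moreover have ev: "\<forall>\<^sub>F t in nhds 0. jb_apply inverse (F t) = jb_inverse (F t)"
    using unit_tangent_eventually_near[OF F zero_less_one] by eventually_elim (simp add: eq)
  ultimately have "((\<lambda>t. jb_inverse (F t)) has_vector_derivative -1 *\<^sub>R X) (at 0)"
    by (subst has_vector_derivative_cong_ev[where g = "\<lambda>t. jb_apply inverse (F t)"])
      (auto dest: eventually_nhds_x_imp_x elim: eventually_mono)
  moreover have "jb_inverse (1::'a) = 1"
    using eq[of 1] jb_apply_scalar[OF d c, where 'a = 'a] by simp
  ultimately show ?thesis using F by (simp add: unit_tangent_def)
qed

lemma unit_tangent_triple:
  assumes "unit_tangent F X" "unit_tangent G Y"
  shows "unit_tangent (\<lambda>t. jb_triple (F t) (G t)) (2 *\<^sub>R X + Y)"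
proof -
  have F: "F 0 = 1" "(F has_vector_derivative X) (at 0)"
    and G: "G 0 = 1" "(G has_vector_derivative Y) (at 0)"
    using assms by (auto simp: unit_tangent_def)
  have "((\<lambda>t. F t * G t) has_vector_derivative Y + X) (at 0)"
    "((\<lambda>t. F t * F t) has_vector_derivative X + X) (at 0)"
    using jb_mult.has_vector_derivative[OF F(2) G(2)] jb_mult.has_vector_derivative[OF F(2) F(2)] F G
    by simp_all
  from jb_mult.has_vector_derivative[OF this(1) F(2)] jb_mult.has_vector_derivative[OF this(2) G(2)]
  have "((\<lambda>t. F t * G t * F t) has_vector_derivative X + (Y + X)) (at 0)"
    "((\<lambda>t. F t * F t * G t) has_vector_derivative Y + (X + X)) (at 0)"
    using F G by simp_all
  then have der: "((\<lambda>t. 2 *\<^sub>R (F t * G t * F t) - F t * F t * G t) has_vector_derivative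
      2 *\<^sub>R (X + (Y + X)) - (Y + (X + X))) (at 0)"
    by (intro has_vector_derivative_diff bounded_linear.has_vector_derivative[OF bounded_linear_scaleR_right])
  have eq: "2 *\<^sub>R (X + (Y + X)) - (Y + (X + X)) = 2 *\<^sub>R X + Y"
    by (simp add: scaleR_2 algebra_simps)
  show ?thesis
    unfolding unit_tangent_def jb_triple_def using der[unfolded eq] F(1) G(1) by (simp add: scaleR_2)
qed

lemma unit_tangent_cong: "unit_tangent F X \<Longrightarrow> X = Y \<Longrightarrow> unit_tangent F Y"
  by simp

text \<open>
  The inner triple product has velocity \<open>Y - X\<close>, its power \<open>l (Y - X)\<close>, and the outer triple product
  adds \<open>X\<close>.
\<close>

lemma unit_tangent_gmean:
  assumes F: "unit_tangent F X" and G: "unit_tangent G Y"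
  shows "unit_tangent (\<lambda>t. jb_gmean l (F t) (G t)) ((1 - l) *\<^sub>R X + l *\<^sub>R Y)"
  unfolding jb_gmean_def
  by (rule unit_tangent_cong, (rule unit_tangent_triple unit_tangent_powr F G)+)
    (simp add: algebra_simps)

text \<open>
  The geometric mean of \<open>F\<^sup>-\<^sup>1\<close> and \<open>G\<close> has velocity \<open>(Y - X)/2\<close>; its power \<open>l\<close> is used twice in
  the triple product.
\<close>

lemma unit_tangent_spectral_gmean:
  assumes F: "unit_tangent F X" and G: "unit_tangent G Y"
  shows "unit_tangent (\<lambda>t. jb_spectral_gmean l (F t) (G t)) ((1 - l) *\<^sub>R X + l *\<^sub>R Y)"
  unfolding jb_spectral_gmean_def
  by (rule unit_tangent_cong,
      (rule unit_tangent_triple unit_tangent_powr unit_tangent_gmean unit_tangent_inverse F G)+)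
    (simp add: algebra_simps)

lemma unit_tangent_arithmetic_mean:
  assumes F: "unit_tangent F X" and G: "unit_tangent G Y"
  shows "unit_tangent (\<lambda>t. (1 - l) *\<^sub>R F t + l *\<^sub>R G t) ((1 - l) *\<^sub>R X + l *\<^sub>R Y)"
  using assms unfolding unit_tangent_def
  by (auto intro!: has_vector_derivative_add
      bounded_linear.has_vector_derivative[OF bounded_linear_scaleR_right] simp flip: scaleR_add_left)

section \<open>Limits of powers\<close>

text \<open>
  On a neighbourhood of the unit the spectrum is positive, where \<open>x powr (1/t) = exp ((1/t) ln x)\<close>.
  The exponent \<open>(1/t) L t\<close> is a difference quotient at \<open>0\<close> of the curve \<open>L = log \<circ> F\<close>.
\<close>

lemma unit_tangent_powr_limit:
  fixes F :: "real \<Rightarrow> 'a::unital_jb_algebra"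
  assumes F: "unit_tangent F X"
  shows "((\<lambda>t. F t jpowr (1 / t)) \<longlongrightarrow> jb_exp X) (at 0)"
proof -
  define L where "L t = jb_apply ln (F t)" for t
  have d: "(ln has_real_derivative 1) (at (1::real))"
    using DERIV_ln[of "1::real"] by simp
  have c: "continuous_on (ball 1 1) (ln :: real \<Rightarrow> real)"
    by (auto intro!: continuous_intros simp: dist_real_def)
  have "L 0 = 0" using F jb_apply_scalar[OF d c, where 'a = 'a] by (simp add: L_def unit_tangent_def)
  have "(L has_vector_derivative X) (at 0)"
    using has_vector_derivative_jb_apply[OF d c, of F X] F by (simp add: L_def [abs_def] unit_tangent_def)
  then have "((\<lambda>t. norm (L t - t *\<^sub>R X) / \<bar>t\<bar>) \<longlongrightarrow> 0) (at 0)"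
    using \<open>L 0 = 0\<close> by (simp add: has_vector_derivative_def has_derivative_at)
  then have "((\<lambda>t. norm ((1 / t) *\<^sub>R L t - X)) \<longlongrightarrow> 0) (at 0)"
  proof (rule Lim_transform_eventually)
    show "\<forall>\<^sub>F t in at 0. norm (L t - t *\<^sub>R X) / \<bar>t\<bar> = norm ((1 / t) *\<^sub>R L t - X)"
    proof (rule eventually_at_topological[THEN iffD2], intro exI[of _ UNIV] conjI ballI impI)
      fix t :: real assume "t \<noteq> 0"
      then have "(1 / t) *\<^sub>R L t - X = (1 / t) *\<^sub>R (L t - t *\<^sub>R X)"
        by (simp add: scaleR_diff_right)
      then show "norm (L t - t *\<^sub>R X) / \<bar>t\<bar> = norm ((1 / t) *\<^sub>R L t - X)" by simp
    qed auto
  qed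
  then have "((\<lambda>t. (1 / t) *\<^sub>R L t) \<longlongrightarrow> X) (at 0)"
    by (rule LIM_zero_cancel[OF tendsto_norm_zero_cancel])
  then have lim: "((\<lambda>t. jb_exp ((1 / t) *\<^sub>R L t)) \<longlongrightarrow> jb_exp X) (at 0)"
    by (rule isCont_tendsto_compose[OF isCont_jb_exp])
  have "\<forall>\<^sub>F t in at 0. jb_exp ((1 / t) *\<^sub>R L t) = F t jpowr (1 / t)"
    using unit_tangent_eventually_near[OF F zero_less_one, THEN filter_leD[OF at_within_le_nhds]]
  proof eventually_elim
    case (elim t)
    have pos: "x > 0" if "x \<in> jb_spectrum (F t)" for x
      using abs_spectrum_le[OF that, of 1] elim by auto
    then have cont: "continuous_on (jb_spectrum (F t)) ln" by (force intro!: continuous_intros)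
    have "jb_exp ((1 / t) *\<^sub>R L t) = jb_exp (jb_apply (\<lambda>x. (1 / t) * ln x) (F t))"
      unfolding L_def by (simp only: jb_apply_scale[OF cont])
    also have "\<dots> = jb_apply (\<lambda>x. exp ((1 / t) * ln x)) (F t)"
      by (intro jb_apply_exp_comp[symmetric] continuous_on_mult continuous_on_const cont)
    also have "\<dots> = F t jpowr (1 / t)"
      unfolding jb_powr_def
    proof (rule jb_apply_cong)
      show "continuous_on (jb_spectrum (F t)) (\<lambda>x. exp ((1 / t) * ln x))"
        by (intro continuous_on_exp continuous_on_mult continuous_on_const cont)
    qed (use pos in \<open>auto simp: powr_def\<close>)
    finally show ?case .
  qed
  with lim show ?thesis by (rule Lim_transform_eventually)
qed

lemma filterlim_inverse_real_at_0: "filterlim (\<lambda>n. inverse (real n)) (at 0) sequentially"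
  unfolding filterlim_at using lim_inverse_n[where 'a = real]
  by (auto intro: eventually_mono[OF eventually_gt_at_top[of 0]])

lemma filterlim_uminus_at_0: "filterlim (uminus :: real \<Rightarrow> real) (at 0) (at 0)"
  unfolding filterlim_at by (auto intro!: tendsto_eq_intros simp: eventually_at_filter)

lemma unit_tangent_powr_limit_sequence:
  assumes F: "unit_tangent F X"
  shows "(\<lambda>n. F (inverse (real n)) jpowr real n) \<longlonglongrightarrow> jb_exp X"
  using filterlim_compose[OF unit_tangent_powr_limit[OF F] filterlim_inverse_real_at_0]
  by (simp add: divide_inverse)

lemma unit_tangent_powr_limit_reflected:
  assumes F: "unit_tangent F X"
  shows "((\<lambda>t. F (- t) jpowr (- 1 / t)) \<longlongrightarrow> jb_exp X) (at 0)"
  using filterlim_compose[OF unit_tangent_powr_limit[OF F] filterlim_uminus_at_0] by simp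

lemma unit_tangent_powr_limit_reflected_sequence:
  assumes F: "unit_tangent F X"
  shows "(\<lambda>n. F (- inverse (real n)) jpowr (- real n)) \<longlonglongrightarrow> jb_exp X"
  using filterlim_compose[OF unit_tangent_powr_limit_reflected[OF F] filterlim_inverse_real_at_0]
  by (simp add: divide_inverse)

theorem corollary3p5:
  fixes A B :: "'a::unital_jb_algebra" and l :: real
  assumes "0 < l" and "l < 1"
  defines "E \<equiv> jb_exp ((1 - l) *\<^sub>R A + l *\<^sub>R B)"
  shows
    "((\<lambda>t::real. ((1 - l) *\<^sub>R jb_exp (t *\<^sub>R A) + l *\<^sub>R jb_exp (t *\<^sub>R B)) jpowr (1 / t)) \<longlongrightarrow> E) (at 0) \<and>
     (\<lambda>n::nat. ((1 - l) *\<^sub>R jb_exp (A /\<^sub>R real n) + l *\<^sub>R jb_exp (B /\<^sub>R real n)) jpowr (real n)) \<longlonglongrightarrow> E \<and>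
     ((\<lambda>t::real. ((1 - l) *\<^sub>R jb_exp (- t *\<^sub>R A) + l *\<^sub>R jb_exp (- t *\<^sub>R B)) jpowr (- 1 / t)) \<longlongrightarrow> E) (at 0) \<and>
     (\<lambda>n::nat. ((1 - l) *\<^sub>R jb_exp (- (A /\<^sub>R real n)) + l *\<^sub>R jb_exp (- (B /\<^sub>R real n))) jpowr (- real n)) \<longlonglongrightarrow> E \<and>
     ((\<lambda>t::real. jb_gmean l (jb_exp (t *\<^sub>R A)) (jb_exp (t *\<^sub>R B)) jpowr (1 / t)) \<longlongrightarrow> E) (at 0) \<and>
     (\<lambda>n::nat. jb_gmean l (jb_exp (A /\<^sub>R real n)) (jb_exp (B /\<^sub>R real n)) jpowr (real n)) \<longlonglongrightarrow> E \<and>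
     ((\<lambda>t::real. jb_spectral_gmean l (jb_exp (t *\<^sub>R A)) (jb_exp (t *\<^sub>R B)) jpowr (1 / t)) \<longlongrightarrow> E) (at 0) \<and>
     (\<lambda>n::nat. jb_spectral_gmean l (jb_exp (A /\<^sub>R real n)) (jb_exp (B /\<^sub>R real n)) jpowr (real n)) \<longlonglongrightarrow> E"
proof -
  note arith = unit_tangent_arithmetic_mean[OF unit_tangent_exp unit_tangent_exp, of l A B]
  note geo = unit_tangent_gmean[OF unit_tangent_exp unit_tangent_exp, of l A B]
  note spec = unit_tangent_spectral_gmean[OF unit_tangent_exp unit_tangent_exp, of l A B]
  show ?thesis
    unfolding E_def scaleR_minus_left[symmetric]
    by (intro conjI unit_tangent_powr_limit[OF arith] unit_tangent_powr_limit_sequence[OF arith]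
      unit_tangent_powr_limit_reflected[OF arith] unit_tangent_powr_limit_reflected_sequence[OF arith]
      unit_tangent_powr_limit[OF geo] unit_tangent_powr_limit_sequence[OF geo]
      unit_tangent_powr_limit[OF spec] unit_tangent_powr_limit_sequence[OF spec])
qed

end
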